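(* Let $\mathcal{D}$ be a weighted oriented graph with $w(v)>1$ for all $v\in V(\mathcal{D})$, and let $I(\mathcal{D})$ be its edge ideal. Suppose that $$I(\mathcal{D})=(xy^{w(y)},\,yz^{w(z)})+I(\mathcal{D}'),$$ where $\mathcal{D}'$ is an oriented rooted tree with root at the vertex $z$; that is, $V(\mathcal{D})=\{x,y\}\cup V(\mathcal{D}')$ with $x,y$ distinct vertices not in $V(\mathcal{D}')$, $z\in V(\mathcal{D}')$ is the root of $\mathcal{D}'$, the edges of $\mathcal{D}'$ are directed away from $z$, and the directed edges of $\mathcal{D}$ are $(x,y)$, $(y,z)$ and the directed edges of $\mathcal{D}'$. Then $I(\mathcal{D})^{(s)}=I(\mathcal{D})^s$ for all $s\geq 1$.
   Context: A weighted oriented graph is a triple $\mathcal{D}=(V(\mathcal{D}),E(\mathcal{D}),w)$, where $V(\mathcal{D})$ is the finite vertex set of a finite simple undirected graph $G$ (the underlying graph), $E(\mathcal{D})\subseteq V(\mathcal{D})\times V(\mathcal{D})$ is a set of directed edges obtained by giving each edge of $G$ exactly one direction ($(u,v)\in E(\mathcal{D})$ means an edge directed from $u$ to $v$), and $w:V(\mathcal{D})\to\mathbb{N}=\{1,2,\dots\}$ is a weight function. Let $R$ be the polynomial ring over a field $k$ whose variables are the vertices of $\mathcal{D}$. The edge ideal of $\mathcal{D}$ is the monomial ideal $I(\mathcal{D})=(\,u\,v^{w(v)} : (u,v)\in E(\mathcal{D})\,)\subseteq R$. The graph $\mathcal{D}'$ carries the restriction of the weight function $w$, and $I(\mathcal{D}')$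 is regarded as an ideal of $R$. An oriented rooted tree with root $z$ is a weighted oriented graph whose underlying graph is a tree with a distinguished vertex $z$ (the root), with all edges directed away from $z$, so that there is a unique directed path from $z$ to any given vertex. For an ideal $I$ of $R$ and $s\ge 1$, the $s$-th symbolic power is $I^{(s)}=\bigcap_{\mathfrak{p}\in\operatorname{Ass}(I)}(I^sR_{\mathfrak{p}}\cap R)$, where $\operatorname{Ass}(I)=\operatorname{Ass}(R/I)$ is the set of all associated primes of $I$ (including embedded ones). *)

theory Defs
  imports
    "HOL-Library.Poly_Mapping"
    "HOL-Algebra.Ideal_Product"
    "HOL-Algebra.QuotRing"
    "Graph_Theory.Digraph_Component"
begin

section \<open>Weighted oriented graphs\<close>

text \<open>
  Antisymmetry together with the absence of loops expresses that the arcs arise by giving each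
  edge of a finite simple graph exactly one direction. The weight function is a total function,
  of which only the values on the vertex set matter; hence a subgraph carries the restricted
  weight function when it is taken with the same \<open>w\<close>.
\<close>

locale weighted_oriented_graph = pair_digraph D
  for D :: "'v pair_pre_digraph" +
  fixes w :: "'v \<Rightarrow> nat"
  assumes one_direction: "(u, v) \<in> parcs D \<Longrightarrow> (v, u) \<notin> parcs D"
    and weight_pos: "v \<in> pverts D \<Longrightarrow> w v \<ge> 1"

text \<open>
  The underlying graph is the symmetric digraph \<^term>\<open>mk_symmetric D\<close>. In it, every edge
  \<open>u\<close>, \<open>v\<close> gives a closed walk \<open>u, v, u\<close> that \<^const>\<open>pre_digraph.cycle\<close> accepts, so undirected
  cycles are the cycles of length at least 3. The library predicate \<^const>\<open>tree\<close> is not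
  suitable, as it excludes only directed cycles.
\<close>

definition underlying_tree :: "'v pair_pre_digraph \<Rightarrow> bool" where
  "underlying_tree D \<longleftrightarrow>
     connected D \<and> (\<nexists>p. pre_digraph.cycle (mk_symmetric D) p \<and> length p \<ge> 3)"

text \<open>
  An arc \<open>(u, v)\<close> is directed away from the root if the path of the underlying tree from the
  root to \<open>v\<close> ends with the step from \<open>u\<close> to \<open>v\<close>. The unique directed paths are a consequence of
  this; they are listed as part of the usual definition.
\<close>

locale oriented_rooted_tree = weighted_oriented_graph D w
  for D :: "'v pair_pre_digraph" and w :: "'v \<Rightarrow> nat" +
  fixes z :: 'v
  assumes underlying_tree: "underlying_tree D"
    and root_in_verts: "z \<in> pverts D"
    and directed_away: "(u, v) \<in> parcs D \<Longrightarrow>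
          \<exists>p. pre_digraph.apath (mk_symmetric D) z (p @ [(u, v)]) v"
    and unique_directed_path: "v \<in> pverts D \<Longrightarrow> \<exists>!p. pre_digraph.apath D z p v"


section \<open>Polynomial ring and edge ideal\<close>

text \<open>
  A polynomial is a finitely supported map from monomials (exponent vectors) to coefficients.
  The polynomial ring in the variables \<open>V\<close> consists of those whose monomials involve only
  variables from \<open>V\<close>.
\<close>

type_synonym ('v, 'k) mpoly = "('v \<Rightarrow>\<^sub>0 nat) \<Rightarrow>\<^sub>0 'k"

definition polynomial_ring :: "'v set \<Rightarrow> ('v, 'k::field) mpoly ring" where
  "polynomial_ring V =
     \<lparr>carrier = {f. \<forall>m\<in>Poly_Mapping.keys f. Poly_Mapping.keys m \<subseteq> V},
      monoid.mult = (*), one = 1, zero = 0, add = (+)\<rparr>"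

definition var :: "'v \<Rightarrow> ('v, 'k::field) mpoly" where
  "var v = Poly_Mapping.single (Poly_Mapping.single v 1) 1"

definition edge_ideal :: "'v pair_pre_digraph \<Rightarrow> ('v \<Rightarrow> nat) \<Rightarrow> ('v, 'k::field) mpoly set" where
  "edge_ideal D w =
     Idl\<^bsub>polynomial_ring (pverts D)\<^esub> {var u * var v ^ w v | u v. (u, v) \<in> parcs D}"


section \<open>Symbolic powers\<close>

text \<open>The \<open>R\<close>-module structure of \<open>R/I\<close> is multiplication by residue classes in the ring \<open>R/I\<close>.\<close>

definition associated_primes :: "('a, 'b) ring_scheme \<Rightarrow> 'a set \<Rightarrow> 'a set set" where
  "associated_primes R I =
     {P. primeideal P R \<and>
         (\<exists>m\<in>carrier (R Quot I).
            P = {r \<in> carrier R. (I +>\<^bsub>R\<^esub> r) \<otimes>\<^bsub>R Quot I\<^esub> m = \<zero>\<^bsub>R Quot I\<^esub>})}"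

text \<open>
  The localization of \<open>R\<close> at a multiplicative set \<open>S\<close>, with fractions as equivalence classes of
  pairs of a numerator and a denominator; \<open>fraction R S a s\<close> is the class of \<open>a / s\<close>.
\<close>

definition fraction_rel :: "('a, 'b) ring_scheme \<Rightarrow> 'a set \<Rightarrow> (('a \<times> 'a) \<times> ('a \<times> 'a)) set" where
  "fraction_rel R S = {((a, s), (b, t)). a \<in> carrier R \<and> s \<in> S \<and> b \<in> carrier R \<and> t \<in> S \<and>
     (\<exists>u\<in>S. u \<otimes>\<^bsub>R\<^esub> (a \<otimes>\<^bsub>R\<^esub> t \<ominus>\<^bsub>R\<^esub> b \<otimes>\<^bsub>R\<^esub> s) = \<zero>\<^bsub>R\<^esub>)}"

definition fraction :: "('a, 'b) ring_scheme \<Rightarrow> 'a set \<Rightarrow> 'a \<Rightarrow> 'a \<Rightarrow> ('a \<times> 'a) set" where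
  "fraction R S a s = fraction_rel R S `` {(a, s)}"

definition localization :: "('a, 'b) ring_scheme \<Rightarrow> 'a set \<Rightarrow> ('a \<times> 'a) set ring" where
  "localization R S =
     \<lparr>carrier = (carrier R \<times> S) // fraction_rel R S,
      monoid.mult = (\<lambda>X Y. \<Union>(a, s)\<in>X. \<Union>(b, t)\<in>Y. fraction R S (a \<otimes>\<^bsub>R\<^esub> b) (s \<otimes>\<^bsub>R\<^esub> t)),
      one = fraction R S \<one>\<^bsub>R\<^esub> \<one>\<^bsub>R\<^esub>,
      zero = fraction R S \<zero>\<^bsub>R\<^esub> \<one>\<^bsub>R\<^esub>,
      add = (\<lambda>X Y. \<Union>(a, s)\<in>X. \<Union>(b, t)\<in>Y.
               fraction R S (a \<otimes>\<^bsub>R\<^esub> t \<oplus>\<^bsub>R\<^esub> b \<otimes>\<^bsub>R\<^esub> s) (s \<otimes>\<^bsub>R\<^esub> t))\<rparr>"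

text \<open>\<open>J R\<^sub>P \<inter> R\<close>: the preimage under \<open>R \<rightarrow> R\<^sub>P\<close> of the ideal generated by the image of \<open>J\<close>.\<close>

definition local_contraction :: "('a, 'b) ring_scheme \<Rightarrow> 'a set \<Rightarrow> 'a set \<Rightarrow> 'a set" where
  "local_contraction R P J =
     (let S = carrier R - P in
      {f \<in> carrier R. fraction R S f \<one>\<^bsub>R\<^esub> \<in> Idl\<^bsub>localization R S\<^esub> ((\<lambda>a. fraction R S a \<one>\<^bsub>R\<^esub>) ` J)})"

text \<open>Ordinary powers of ideals are powers in the library's structure of ideals of \<open>R\<close>.\<close>

definition ideal_power :: "('a, 'b) ring_scheme \<Rightarrow> 'a set \<Rightarrow> nat \<Rightarrow> 'a set" where
  "ideal_power R I s = I [^]\<^bsub>ideals_set R\<^esub> s"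

definition symbolic_power :: "('a, 'b) ring_scheme \<Rightarrow> 'a set \<Rightarrow> nat \<Rightarrow> 'a set" where
  "symbolic_power R I s =
     carrier R \<inter> (\<Inter>P\<in>associated_primes R I. local_contraction R P (ideal_power R I s))"

end

theory Submission
  imports Defs "HOL-Computational_Algebra.Formal_Power_Series"
begin

text \<open>
  Write \<open>I\<close> for the edge ideal. All weights being greater than 1, the primes generated by all
  variables except \<open>x\<close>, respectively except \<open>y\<close>, are associated to \<open>I\<close>. Localizing at them shows
  that every monomial of an element of the symbolic power lies in \<open>I\<^sup>s\<close> after multiplication by a
  power of \<open>x\<close>, and also after multiplication by a power of \<open>y\<close>. So it has two representations
  as a multiple of a product of \<open>s\<close> generators, the first violating the exponent bound at most
  at \<open>x\<close> and the second at most at \<open>y\<close>. The arcs below \<open>z\<close> can be taken greedily from the leaves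
  upwards, hence equally in both representations; what is left concerns the path \<open>x, y, z\<close>,
  where the two representations combine to one without violation.
\<close>


section \<open>Localization\<close>

text \<open>Two associated primes suffice: leaving out the others only enlarges the intersection,
  and \<open>I^s\<close> lies in every contraction anyway. Clearing a denominator multiplies by an
  arbitrary polynomial outside the prime, whose terms may cancel against each other. Therefore
  coefficients are collected into power series in the one variable outside the prime; these form a
  domain. The greedy choice can agree on both sides because an arc below \<open>z\<close> involves
  neither \<open>x\<close> nor \<open>y\<close>: both of its bounds hold in both representations,
  and its largest possible multiplicity depends on the monomial alone. On the path, suppose that the
  first representation uses the arc into \<open>y\<close> \<open>j\<close> times more often than the
  second. Trading these \<open>j\<close> copies for copies of the arc into \<open>z\<close> frees
  \<open>w y\<close> units at \<open>y\<close> per copy and costs one there, and it restores the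
  bound at \<open>x\<close>. The bound at \<open>z\<close> is kept by never exceeding the second
  representation's multiplicity of that arc.\<close>

lemma UN_UN_pairs_eq:
  assumes "p \<in> X" "q \<in> Y"
    and "\<And>a s b t. (a, s) \<in> X \<Longrightarrow> (b, t) \<in> Y \<Longrightarrow> F a s b t = C"
  shows "(\<Union>(a, s)\<in>X. \<Union>(b, t)\<in>Y. F a s b t) = C"
proof (rule SUP_eq_const)
  fix p assume "p \<in> X"
  then have "(\<Union>(b, t)\<in>Y. F (fst p) (snd p) b t) = C"
    using assms by (intro SUP_eq_const) (auto simp: split_beta)
  then show "(case p of (a, s) \<Rightarrow> \<Union>(b, t)\<in>Y. F a s b t) = C"
    by (simp add: split_beta)
qed (use assms in auto)

locale localization_setting = cring R for R (structure) +
  fixes S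
  assumes S_subset: "S \<subseteq> carrier R"
    and one_in_S: "\<one> \<in> S"
    and S_mult: "s \<in> S \<Longrightarrow> t \<in> S \<Longrightarrow> s \<otimes> t \<in> S"
begin

lemma S_carrier [simp]: "s \<in> S \<Longrightarrow> s \<in> carrier R"
  using S_subset by blast

lemma fraction_rel_iff:
  "((a, s), (b, t)) \<in> fraction_rel R S \<longleftrightarrow>
     a \<in> carrier R \<and> s \<in> S \<and> b \<in> carrier R \<and> t \<in> S \<and> (\<exists>u\<in>S. u \<otimes> (a \<otimes> t) = u \<otimes> (b \<otimes> s))"
proof -
  have "u \<otimes> (a \<otimes> t \<ominus> b \<otimes> s) = \<zero> \<longleftrightarrow> u \<otimes> (a \<otimes> t) = u \<otimes> (b \<otimes> s)"
    if "a \<in> carrier R" "s \<in> S" "b \<in> carrier R" "t \<in> S" "u \<in> S" for u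
  proof -
    have "u \<otimes> (a \<otimes> t \<ominus> b \<otimes> s) = u \<otimes> (a \<otimes> t) \<ominus> u \<otimes> (b \<otimes> s)"
      using that by (simp add: minus_eq r_distr r_minus)
    then show ?thesis
      using that minus_equality[of "u \<otimes> (a \<otimes> t)" "\<ominus> (u \<otimes> (b \<otimes> s))"]
      by (auto simp: minus_eq r_neg)
  qed
  then show ?thesis
    unfolding fraction_rel_def by blast
qed

lemma fraction_rel_trans:
  assumes "((a, s), (b, t)) \<in> fraction_rel R S" "((b, t), (c, r)) \<in> fraction_rel R S"
  shows "((a, s), (c, r)) \<in> fraction_rel R S"
proof -
  from assms obtain u v where carr: "a \<in> carrier R" "s \<in> S" "b \<in> carrier R" "t \<in> S"
      "c \<in> carrier R" "r \<in> S" "u \<in> S" "v \<in> S"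
    and u: "u \<otimes> (a \<otimes> t) = u \<otimes> (b \<otimes> s)" and v: "v \<otimes> (b \<otimes> r) = v \<otimes> (c \<otimes> t)"
    unfolding fraction_rel_iff by blast
  have "(u \<otimes> v \<otimes> t) \<otimes> (a \<otimes> r) = v \<otimes> r \<otimes> (u \<otimes> (a \<otimes> t))"
    using carr by (simp add: m_ac)
  also have "\<dots> = u \<otimes> s \<otimes> (v \<otimes> (b \<otimes> r))"
    unfolding u using carr by (simp add: m_ac)
  also have "\<dots> = (u \<otimes> v \<otimes> t) \<otimes> (c \<otimes> s)"
    unfolding v using carr by (simp add: m_ac)
  finally show ?thesis
    using carr unfolding fraction_rel_iff by (blast intro: S_mult)
qed

lemma equiv_fraction_rel: "equiv (carrier R \<times> S) (fraction_rel R S)"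
proof (rule equivI)
  show "fraction_rel R S \<subseteq> (carrier R \<times> S) \<times> (carrier R \<times> S)"
    by (auto simp: fraction_rel_def)
  show "refl_on (carrier R \<times> S) (fraction_rel R S)"
    using one_in_S by (auto simp: refl_on_def fraction_rel_iff)
  show "sym (fraction_rel R S)"
    unfolding sym_def by (metis fraction_rel_iff surj_pair)
  show "trans (fraction_rel R S)"
    unfolding trans_def by (auto intro: fraction_rel_trans)
qed

lemma fraction_eq_iff:
  assumes "a \<in> carrier R" "s \<in> S" "b \<in> carrier R" "t \<in> S"
  shows "fraction R S a s = fraction R S b t \<longleftrightarrow> (\<exists>u\<in>S. u \<otimes> (a \<otimes> t) = u \<otimes> (b \<otimes> s))"
  using eq_equiv_class_iff[OF equiv_fraction_rel, of "(a, s)" "(b, t)"] assms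
  by (simp add: fraction_def fraction_rel_iff)

lemma fraction_eqI:
  assumes "a \<in> carrier R" "s \<in> S" "b \<in> carrier R" "t \<in> S" "a \<otimes> t = b \<otimes> s"
  shows "fraction R S a s = fraction R S b t"
  using assms one_in_S by (auto simp: fraction_eq_iff)

lemma carrier_localization:
  "carrier (localization R S) = {fraction R S a s | a s. a \<in> carrier R \<and> s \<in> S}"
  by (auto simp: localization_def quotient_def fraction_def)

lemma fraction_closed:
  "a \<in> carrier R \<Longrightarrow> s \<in> S \<Longrightarrow> fraction R S a s \<in> carrier (localization R S)"
  unfolding carrier_localization by blast

lemma mem_fraction_iff: "(b, t) \<in> fraction R S a s \<longleftrightarrow> ((a, s), (b, t)) \<in> fraction_rel R S"
  by (simp add: fraction_def)

lemma mem_fraction_self: "a \<in> carrier R \<Longrightarrow> s \<in> S \<Longrightarrow> (a, s) \<in> fraction R S a s"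
  using one_in_S by (auto simp: mem_fraction_iff fraction_rel_iff)

text \<open>The operations are unions over all pairs of representatives. Once the value is
  independent of the representatives, such a union is that of a constant nonempty family.\<close>

lemma mult_fraction:
  assumes "a \<in> carrier R" "s \<in> S" "b \<in> carrier R" "t \<in> S"
  shows "fraction R S a s \<otimes>\<^bsub>localization R S\<^esub> fraction R S b t = fraction R S (a \<otimes> b) (s \<otimes> t)"
proof -
  have eq: "fraction R S (a' \<otimes> b') (s' \<otimes> t') = fraction R S (a \<otimes> b) (s \<otimes> t)"
    if "(a', s') \<in> fraction R S a s" and "(b', t') \<in> fraction R S b t" for a' s' b' t'
  proof -
    from that obtain u v where carr: "a' \<in> carrier R" "s' \<in> S" "b' \<in> carrier R" "t' \<in> S" "u \<in> S" "v \<in> S"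
      and u: "u \<otimes> (a \<otimes> s') = u \<otimes> (a' \<otimes> s)" and v: "v \<otimes> (b \<otimes> t') = v \<otimes> (b' \<otimes> t)"
      unfolding mem_fraction_iff fraction_rel_iff by blast
    have "(u \<otimes> v) \<otimes> ((a' \<otimes> b') \<otimes> (s \<otimes> t)) = (u \<otimes> (a' \<otimes> s)) \<otimes> (v \<otimes> (b' \<otimes> t))"
      using carr assms by (simp add: m_ac)
    also have "\<dots> = (u \<otimes> v) \<otimes> ((a \<otimes> b) \<otimes> (s' \<otimes> t'))"
      unfolding u[symmetric] v[symmetric] using carr assms by (simp add: m_ac)
    finally show ?thesis
      using carr assms S_mult by (subst fraction_eq_iff) blast+
  qed
  show ?thesis
    unfolding localization_def monoid.simps
    by (rule UN_UN_pairs_eq[OF mem_fraction_self mem_fraction_self eq]) (use assms in auto)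
qed

lemma add_fraction:
  assumes "a \<in> carrier R" "s \<in> S" "b \<in> carrier R" "t \<in> S"
  shows "fraction R S a s \<oplus>\<^bsub>localization R S\<^esub> fraction R S b t =
    fraction R S (a \<otimes> t \<oplus> b \<otimes> s) (s \<otimes> t)"
proof -
  have eq: "fraction R S (a' \<otimes> t' \<oplus> b' \<otimes> s') (s' \<otimes> t') = fraction R S (a \<otimes> t \<oplus> b \<otimes> s) (s \<otimes> t)"
    if "(a', s') \<in> fraction R S a s" and "(b', t') \<in> fraction R S b t" for a' s' b' t'
  proof -
    from that obtain u v where carr: "a' \<in> carrier R" "s' \<in> S" "b' \<in> carrier R" "t' \<in> S" "u \<in> S" "v \<in> S"
      and u: "u \<otimes> (a \<otimes> s') = u \<otimes> (a' \<otimes> s)" and v: "v \<otimes> (b \<otimes> t') = v \<otimes> (b' \<otimes> t)"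
      unfolding mem_fraction_iff fraction_rel_iff by blast
    have "(u \<otimes> v) \<otimes> ((a' \<otimes> t' \<oplus> b' \<otimes> s') \<otimes> (s \<otimes> t)) =
        (u \<otimes> (a' \<otimes> s)) \<otimes> (v \<otimes> t' \<otimes> t) \<oplus> (v \<otimes> (b' \<otimes> t)) \<otimes> (u \<otimes> s' \<otimes> s)"
      using carr assms by (simp add: m_ac l_distr r_distr)
    also have "\<dots> = (u \<otimes> v) \<otimes> ((a \<otimes> t \<oplus> b \<otimes> s) \<otimes> (s' \<otimes> t'))"
      unfolding u[symmetric] v[symmetric] using carr assms by (simp add: m_ac l_distr r_distr)
    finally show ?thesis
      using carr assms S_mult by (subst fraction_eq_iff) (blast intro: a_closed m_closed S_carrier)+
  qed
  show ?thesis
    unfolding localization_def ring.simps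
    by (rule UN_UN_pairs_eq[OF mem_fraction_self mem_fraction_self eq]) (use assms in auto)
qed

lemma zero_localization: "\<zero>\<^bsub>localization R S\<^esub> = fraction R S \<zero> \<one>"
  and one_localization: "\<one>\<^bsub>localization R S\<^esub> = fraction R S \<one> \<one>"
  by (simp_all add: localization_def)

lemma fraction_neg_add:
  assumes "a \<in> carrier R" "s \<in> S"
  shows "fraction R S (\<ominus> a) s \<oplus>\<^bsub>localization R S\<^esub> fraction R S a s = \<zero>\<^bsub>localization R S\<^esub>"
proof -
  have "\<ominus> a \<otimes> s \<oplus> a \<otimes> s = \<zero>"
    using assms by (simp add: l_neg l_distr[symmetric])
  then show ?thesis
    unfolding zero_localization using assms S_mult one_in_S
    by (simp add: add_fraction) (rule fraction_eqI; simp)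
qed

text \<open>The predicate \<open>ideal\<close> includes the ring axioms, so they must be verified
  before any ideal of the localization can be exhibited.\<close>

lemma cring_localization: "cring (localization R S)"
proof (rule cringI)
  let ?L = "localization R S"
  note simps = carrier_localization add_fraction mult_fraction zero_localization one_localization
    S_mult one_in_S
  show "abelian_group ?L"
  proof (rule abelian_groupI)
    fix X assume "X \<in> carrier ?L"
    then obtain a s where [simp]: "a \<in> carrier R" "s \<in> S" "X = fraction R S a s"
      by (auto simp: simps)
    show "\<zero>\<^bsub>?L\<^esub> \<oplus>\<^bsub>?L\<^esub> X = X"
      by (simp add: simps)
    show "\<exists>Y\<in>carrier ?L. Y \<oplus>\<^bsub>?L\<^esub> X = \<zero>\<^bsub>?L\<^esub>"
    proof (rule bexI)
      show "fraction R S (\<ominus> a) s \<oplus>\<^bsub>?L\<^esub> X = \<zero>\<^bsub>?L\<^esub>"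
        by (simp add: fraction_neg_add)
      show "fraction R S (\<ominus> a) s \<in> carrier ?L"
        by (simp add: fraction_closed)
    qed
    fix Y assume "Y \<in> carrier ?L"
    then obtain b t where [simp]: "b \<in> carrier R" "t \<in> S" "Y = fraction R S b t"
      by (auto simp: simps)
    show "X \<oplus>\<^bsub>?L\<^esub> Y \<in> carrier ?L"
      by (simp add: add_fraction fraction_closed S_mult)
    show "X \<oplus>\<^bsub>?L\<^esub> Y = Y \<oplus>\<^bsub>?L\<^esub> X"
      by (auto simp: simps a_comm m_comm intro!: arg_cong2[where f = "fraction R S"])
    fix Z assume "Z \<in> carrier ?L"
    then obtain c r where [simp]: "c \<in> carrier R" "r \<in> S" "Z = fraction R S c r"
      by (auto simp: simps)
    show "X \<oplus>\<^bsub>?L\<^esub> Y \<oplus>\<^bsub>?L\<^esub> Z = X \<oplus>\<^bsub>?L\<^esub> (Y \<oplus>\<^bsub>?L\<^esub> Z)"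
      by (auto simp: simps l_distr r_distr a_assoc m_ac intro!: arg_cong2[where f = "fraction R S"])
  qed (simp_all add: zero_localization one_localization fraction_closed one_in_S)
  show "comm_monoid ?L"
  proof (rule comm_monoidI)
    fix X assume "X \<in> carrier ?L"
    then obtain a s where [simp]: "a \<in> carrier R" "s \<in> S" "X = fraction R S a s"
      by (auto simp: simps)
    show "\<one>\<^bsub>?L\<^esub> \<otimes>\<^bsub>?L\<^esub> X = X"
      by (simp add: simps)
    fix Y assume "Y \<in> carrier ?L"
    then obtain b t where [simp]: "b \<in> carrier R" "t \<in> S" "Y = fraction R S b t"
      by (auto simp: simps)
    show "X \<otimes>\<^bsub>?L\<^esub> Y \<in> carrier ?L"
      by (simp add: mult_fraction fraction_closed S_mult)
    show "X \<otimes>\<^bsub>?L\<^esub> Y = Y \<otimes>\<^bsub>?L\<^esub> X"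
      by (simp add: simps m_comm)
    fix Z assume "Z \<in> carrier ?L"
    then obtain c r where [simp]: "c \<in> carrier R" "r \<in> S" "Z = fraction R S c r"
      by (auto simp: simps)
    show "X \<otimes>\<^bsub>?L\<^esub> Y \<otimes>\<^bsub>?L\<^esub> Z = X \<otimes>\<^bsub>?L\<^esub> (Y \<otimes>\<^bsub>?L\<^esub> Z)"
      by (simp add: simps m_assoc)
  qed (simp_all add: zero_localization one_localization fraction_closed one_in_S)
  fix X Y Z assume "X \<in> carrier ?L" "Y \<in> carrier ?L" "Z \<in> carrier ?L"
  then obtain a s b t c r where [simp]: "a \<in> carrier R" "s \<in> S" "X = fraction R S a s"
      "b \<in> carrier R" "t \<in> S" "Y = fraction R S b t" "c \<in> carrier R" "r \<in> S" "Z = fraction R S c r"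
    by (auto simp: simps)
  show "(X \<oplus>\<^bsub>?L\<^esub> Y) \<otimes>\<^bsub>?L\<^esub> Z = X \<otimes>\<^bsub>?L\<^esub> Z \<oplus>\<^bsub>?L\<^esub> Y \<otimes>\<^bsub>?L\<^esub> Z"
    by (simp add: simps) (rule fraction_eqI; simp add: simps l_distr r_distr m_ac)
qed

section \<open>Extension and contraction of ideals\<close>

lemma ideal_fractions:
  assumes "ideal J R"
  shows "ideal {fraction R S a s | a s. a \<in> J \<and> s \<in> S} (localization R S)" (is "ideal ?K ?L")
proof -
  interpret J: ideal J R by fact
  interpret L: cring ?L by (rule cring_localization)
  have fr: "fraction R S a s \<in> carrier ?L" if "a \<in> J" "s \<in> S" for a s
    using that by (simp add: fraction_closed J.Icarr)
  have mem: "fraction R S a s \<in> ?K" if "a \<in> J" "s \<in> S" for a s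
    using that by blast
  have mult: "X \<otimes>\<^bsub>?L\<^esub> A \<in> ?K" if A: "A \<in> ?K" and X: "X \<in> carrier ?L" for A X
  proof -
    obtain a s where 1: "A = fraction R S a s" "a \<in> J" "s \<in> S" using A by blast
    obtain b t where 2: "X = fraction R S b t" "b \<in> carrier R" "t \<in> S"
      using X by (auto simp: carrier_localization)
    show ?thesis
      unfolding 1 2 using 1 2 by (subst mult_fraction) (auto intro!: mem J.I_l_closed S_mult)
  qed
  show ?thesis
  proof (rule idealI)
    show "ring ?L" by (rule L.ring_axioms)
    show "subgroup ?K (add_monoid ?L)"
    proof (rule L.add.subgroupI)
      show "?K \<subseteq> carrier ?L" using fr by blast
      show "?K \<noteq> {}" using J.zero_closed one_in_S by blast
      show "\<ominus>\<^bsub>?L\<^esub> A \<in> ?K" if A: "A \<in> ?K" for A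
      proof -
        obtain a s where 1: "A = fraction R S a s" "a \<in> J" "s \<in> S" using A by blast
        have "\<ominus>\<^bsub>?L\<^esub> A = fraction R S (\<ominus> a) s"
          unfolding 1 using 1 by (intro L.minus_equality fraction_neg_add fr J.a_inv_closed) auto
        with 1 show ?thesis by (auto intro!: mem J.a_inv_closed)
      qed
      show "A \<oplus>\<^bsub>?L\<^esub> B \<in> ?K" if A: "A \<in> ?K" and B: "B \<in> ?K" for A B
      proof -
        obtain a s where 1: "A = fraction R S a s" "a \<in> J" "s \<in> S" using A by blast
        obtain b t where 2: "B = fraction R S b t" "b \<in> J" "t \<in> S" using B by blast
        show ?thesis
          unfolding 1 2 using 1 2
          by (subst add_fraction) (simp_all add: mem J.I_r_closed J.a_closed S_mult del: mem_Collect_eq)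
      qed
    qed
    fix A X assume A: "A \<in> ?K" and X: "X \<in> carrier ?L"
    then show "X \<otimes>\<^bsub>?L\<^esub> A \<in> ?K" by (rule mult)
    moreover have "A \<in> carrier ?L" using A fr by blast
    ultimately show "A \<otimes>\<^bsub>?L\<^esub> X \<in> ?K" using X by (simp only: L.m_comm)
  qed
qed

text \<open>\<open>Idl\<close> is the intersection of all ideals above the image of
  \<open>J\<close>, and the fractions with numerator in \<open>J\<close> are one of them. An
  equation \<open>f/1 = a/s\<close> then means \<open>u s f = u a\<close> for some \<open>u\<close>
  in \<open>S\<close>.\<close>

lemma fraction_mem_extension:
  assumes J: "ideal J R" and f: "f \<in> carrier R"
    and mem: "fraction R S f \<one> \<in> Idl\<^bsub>localization R S\<^esub> ((\<lambda>a. fraction R S a \<one>) ` J)"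
  shows "\<exists>u\<in>S. u \<otimes> f \<in> J"
proof -
  interpret J: ideal J R by fact
  have "(\<lambda>a. fraction R S a \<one>) ` J \<subseteq> {fraction R S a s | a s. a \<in> J \<and> s \<in> S}"
    using one_in_S by blast
  then have "fraction R S f \<one> \<in> {fraction R S a s | a s. a \<in> J \<and> s \<in> S}"
    using mem ideal_fractions[OF J] unfolding genideal_def by blast
  then obtain a s where "a \<in> J" "s \<in> S" "fraction R S f \<one> = fraction R S a s" by blast
  then obtain u where u: "u \<in> S" "u \<otimes> (f \<otimes> s) = u \<otimes> (a \<otimes> \<one>)"
    using f one_in_S by (auto simp: fraction_eq_iff)
  then have "(u \<otimes> s) \<otimes> f = u \<otimes> a"
    using f \<open>s \<in> S\<close> \<open>a \<in> J\<close> by (simp add: m_ac)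
  also have "\<dots> \<in> J"
    using u \<open>a \<in> J\<close> by (intro J.I_l_closed) auto
  finally show ?thesis
    using u \<open>s \<in> S\<close> S_mult by blast
qed

end

lemma local_contractionD:
  assumes P: "primeideal P R" and J: "ideal J R" and f: "f \<in> local_contraction R P J"
  shows "\<exists>u\<in>carrier R - P. u \<otimes>\<^bsub>R\<^esub> f \<in> J"
proof -
  interpret P: primeideal P R by fact
  interpret localization_setting R "carrier R - P"
  proof
    show "\<one>\<^bsub>R\<^esub> \<in> carrier R - P"
      using P.one_imp_carrier P.I_notcarr by auto
  qed (use P.I_prime in auto)
  show ?thesis
    using fraction_mem_extension[OF J] f by (auto simp: local_contraction_def Let_def)
qed

text \<open>The easy inclusion: \<open>a/1\<close> lies in every ideal containing the image of
  \<open>J\<close>, whatever \<open>P\<close> is.\<close>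

lemma subset_local_contraction:
  assumes "J \<subseteq> carrier R"
  shows "J \<subseteq> local_contraction R P J"
  using assms by (auto simp: local_contraction_def Let_def genideal_def)


section \<open>Multiplicities of the arcs of a rooted tree\<close>

text \<open>
  For a rooted forest given by its non-root vertices \<open>N\<close> and the parent function \<open>par\<close>,
  \<open>load N par w c\<close> is the exponent vector of the product of the monomials
  \<open>(par v) * v ^ w v\<close> taken with multiplicities \<open>c v\<close>.
\<close>

definition load :: "'v set \<Rightarrow> ('v \<Rightarrow> 'v) \<Rightarrow> ('v \<Rightarrow> nat) \<Rightarrow> ('v \<Rightarrow> nat) \<Rightarrow> 'v \<Rightarrow> nat" where
  "load N par w c u = (if u \<in> N then w u * c u else 0) + sum c {v \<in> N. par v = u}"

lemma load_mono:
  assumes "finite N" "\<And>v. v \<in> N \<Longrightarrow> c v \<le> d v"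
  shows "load N par w c u \<le> load N par w d u"
  using assms unfolding load_def by (auto intro!: add_mono sum_mono)

lemma load_update:
  assumes "finite N" "v \<in> N"
  shows "load N par w (c(v := Suc (c v))) u =
    load N par w c u + (if u = v then w v else 0) + (if u = par v then 1 else 0)"
proof -
  have "sum (c(v := Suc (c v))) A = sum c A + (if v \<in> A then 1 else 0)" if "finite A" for A
  proof (cases "v \<in> A")
    case True
    then have "A = insert v (A - {v})" by blast
    then have "sum (c(v := Suc (c v))) A = Suc (c v) + sum c (A - {v})" and "sum c A = c v + sum c (A - {v})"
      using that by (metis (no_types, lifting) Diff_iff fun_upd_apply singletonI sum.cong sum.remove True)+
    then show ?thesis using True by simp
  qed (auto intro: sum.cong)
  then show ?thesis
    using assms by (simp add: load_def)
qed

lemma sum_update_Suc: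
  fixes c :: "'v \<Rightarrow> nat"
  assumes "finite N" "v \<in> N"
  shows "sum (c(v := Suc (c v))) N = Suc (sum c N)"
  using assms by (simp add: sum.remove fun_upd_def)

lemma exists_sum_eq_le:
  fixes c :: "'v \<Rightarrow> nat"
  assumes "finite N" "s \<le> sum c N"
  shows "\<exists>d. (\<forall>v\<in>N. d v \<le> c v) \<and> sum d N = s"
  using assms(2)
proof (induction "sum c N - s" arbitrary: s)
  case 0
  then show ?case by auto
next
  case (Suc k)
  then obtain d where d: "\<forall>v\<in>N. d v \<le> c v" "sum d N = Suc s"
    by (metis Suc_diff_Suc Suc_leI diff_Suc_1 zero_less_Suc zero_less_diff)
  then obtain v where v: "v \<in> N" "d v > 0"
    by (metis gr_zeroI sum.neutral zero_less_Suc less_numeral_extra(3))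
  let ?e = "d(v := d v - 1)"
  have "d = ?e(v := Suc (?e v))" using v by auto
  then have "Suc (sum ?e N) = Suc s"
    using sum_update_Suc[OF assms(1) v(1), of ?e] d by simp
  then show ?case
    using d v by (intro exI[of _ ?e]) (auto intro: le_trans[OF diff_le_self])
qed

text \<open>Each unit added at the leaf is paid for by a unit at its parent or at a sibling.\<close>

lemma saturate_leaf:
  assumes N: "finite N" "v \<in> N" and leaf: "\<And>u. u \<in> N \<Longrightarrow> par u \<noteq> v"
    and w: "\<And>u. u \<in> N \<Longrightarrow> w u > 0" and p: "par v \<in> N" and W: "v \<in> W" "par v \<in> W"
    and c: "\<And>u. u \<in> W \<Longrightarrow> load N par w c u \<le> m u"
  shows "\<exists>d. d v = min (m v div w v) (m (par v)) \<and>
    (\<forall>u\<in>W. load N par w d u \<le> m u) \<and> sum c N \<le> sum d N"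
proof -
  \<comment> \<open>An upper bound for the multiplicity of \<open>v\<close> in any solution. It does
    not depend on \<open>c\<close>, so two different solutions can be brought to the same
    value.\<close>
  define g where "g = min (m v div w v) (m (par v))"
  have load_v: "load N par w d v = w v * d v" for d
    using leaf N by (auto simp: load_def intro!: sum.neutral)
  have "c v \<le> g"
  proof -
    have "w v * c v \<le> m v" using c[OF W(1)] by (simp add: load_v)
    then have "c v \<le> m v div w v"
      using w[OF N(2)] by (simp add: less_eq_div_iff_mult_less_eq mult.commute)
    moreover have "c v \<le> sum c {u \<in> N. par u = par v}"
      using N by (intro member_le_sum) auto
    then have "c v \<le> m (par v)"
      using c[OF W(2)] by (simp add: load_def)
    ultimately show ?thesis by (simp add: g_def)
  qed
  then show ?thesis
    unfolding g_def[symmetric] using c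
  proof (induction "g - c v" arbitrary: c)
    case 0
    then show ?case by (intro exI[of _ c]) auto
  next
    case (Suc k)
    let ?c' = "c(v := Suc (c v))"
    have lt: "c v < g" using Suc.hyps(2) by simp
    have par_v: "par v \<noteq> v" using leaf N by blast
    have room_v: "load N par w c v + w v \<le> m v"
    proof -
      have "Suc (c v) \<le> m v div w v" using lt by (simp add: g_def)
      then have "Suc (c v) * w v \<le> m v"
        using w[OF N(2)] by (simp add: less_eq_div_iff_mult_less_eq)
      then show ?thesis by (simp add: load_v algebra_simps)
    qed
    show ?case
    proof (cases "load N par w c (par v) < m (par v)")
      case True
      have "\<exists>d. d v = g \<and> (\<forall>u\<in>W. load N par w d u \<le> m u) \<and> sum ?c' N \<le> sum d N"
      proof (rule Suc.hyps(1))
        show "load N par w ?c' u \<le> m u" if "u \<in> W" for u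
          using Suc.prems(2)[OF that] True room_v par_v by (auto simp: load_update N)
      qed (use Suc.hyps(2) lt in auto)
      then show ?thesis
        using sum_update_Suc[OF N, of c] by auto
    next
      case False
      \<comment> \<open>The bound at \<open>par v\<close> is exhausted although
        \<open>c v < g \<le> m (par v)\<close>, so another arc loads \<open>par v\<close> too: the
        arc into \<open>par v\<close> or one into a sibling of \<open>v\<close>.\<close>
      have "c v < load N par w c (par v)"
        using False lt by (simp add: g_def)
      moreover have "load N par w c (par v) = w (par v) * c (par v) + (c v + sum c ({u \<in> N. par u = par v} - {v}))"
        using N p by (simp add: load_def sum.remove)
      ultimately obtain q where q: "q \<in> N" "c q > 0" "q \<noteq> v" "q = par v \<or> par q = par v"
      proof (cases "c (par v) > 0")
        case True
        then show ?thesis using that p par_v by blast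
      next
        case 0: False
        assume "c v < load N par w c (par v)"
          "load N par w c (par v) = w (par v) * c (par v) + (c v + sum c ({u \<in> N. par u = par v} - {v}))"
        with 0 have "sum c ({u \<in> N. par u = par v} - {v}) \<noteq> 0" by simp
        then obtain q where "q \<in> {u \<in> N. par u = par v} - {v}" "c q \<noteq> 0"
          by (meson sum.neutral)
        then show ?thesis using that by blast
      qed
      define e where "e = c(q := c q - 1)"
      have ce: "c = e(q := Suc (e q))" using q by (auto simp: e_def)
      let ?e' = "e(v := Suc (e v))"
      have ev: "e v = c v" using q by (simp add: e_def)
      have load_c: "load N par w c u = load N par w e u + (if u = q then w q else 0) + (if u = par q then 1 else 0)" for u
        by (subst ce) (rule load_update[OF N(1) q(1)])
      have sum_c: "sum c N = Suc (sum e N)"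
        by (subst ce) (rule sum_update_Suc[OF N(1) q(1)])
      have "\<exists>d. d v = g \<and> (\<forall>u\<in>W. load N par w d u \<le> m u) \<and> sum ?e' N \<le> sum d N"
      proof (rule Suc.hyps(1))
        show "load N par w ?e' u \<le> m u" if "u \<in> W" for u
        proof -
          have "load N par w ?e' u = load N par w e u + (if u = v then w v else 0) + (if u = par v then 1 else 0)"
            by (rule load_update[OF N])
          \<comment> \<open>Dropping one copy of \<open>q\<close> frees one unit at
            \<open>par v\<close> if \<open>q\<close> is a sibling, and \<open>w q \<ge> 1\<close>
            units if \<open>q\<close> is \<open>par v\<close>.\<close>
          moreover have "load N par w e u + (if u = par v then 1 else 0) \<le> load N par w c u"
            using q(4) w[OF q(1)] by (auto simp: load_c)
          moreover have "load N par w c u + (if u = v then w v else 0) \<le> m u"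
            using Suc.prems(2)[OF that] room_v by auto
          ultimately show ?thesis by linarith
        qed
      qed (use Suc.hyps(2) lt ev in auto)
      then show ?thesis
        using sum_update_Suc[OF N, of e] sum_c by auto
    qed
  qed
qed

lemma load_remove_leaf:
  assumes "finite N" "v \<in> N" "\<And>u. u \<in> N \<Longrightarrow> par u \<noteq> v"
  shows "load N par w c u =
    (if u = v then w v * c v else load (N - {v}) par w c u + (if u = par v then c v else 0))"
proof -
  have "{a \<in> N. par a = v} = {}" "v \<noteq> par v" using assms by (auto dest: sym)
  moreover have "sum c {a \<in> N. par a = u} =
      sum c {a \<in> N - {v}. par a = u} + (if u = par v then c v else 0)"
  proof (cases "u = par v")
    case True
    then have "{a \<in> N. par a = u} - {v} = {a \<in> N - {v}. par a = u}" by auto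
    then show ?thesis
      using assms True by (simp add: sum.remove[of _ v])
  next
    case False
    then have "{a \<in> N. par a = u} = {a \<in> N - {v}. par a = u}" by auto
    then show ?thesis using False by simp
  qed
  ultimately show ?thesis
    using assms by (auto simp: load_def)
qed

text \<open>
  Saturating a leaf of maximal depth in both solutions makes them agree there, so that this leaf
  can be removed; only the path \<open>x, y, z\<close> remains in the end.
\<close>

lemma glue_solutions:
  assumes "finite N" "y \<in> N" "z \<in> N" "x \<notin> N" "y \<noteq> z" "par y = x" "par z = y"
    and "\<And>v. v \<in> N - {y, z} \<Longrightarrow> par v \<in> N - {y}"
    and "\<And>v. v \<in> N - {y, z} \<Longrightarrow> (r (par v) :: nat) < r v"
    and "\<And>v. v \<in> N \<Longrightarrow> w v > 0"
    and "\<And>u. u \<noteq> x \<Longrightarrow> load N par w c u \<le> m u" and "s \<le> sum c N"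
    and "\<And>u. u \<noteq> y \<Longrightarrow> load N par w d u \<le> m u" and "s \<le> sum d N"
  shows "\<exists>e. (\<forall>u. load N par w e u \<le> m u) \<and> s \<le> sum e N"
  using assms
proof (induction "card N" arbitrary: N m c d s rule: less_induct)
  case less
  note N = less.prems(1-5) and par = less.prems(6-8) and rank = less.prems(9) and w = less.prems(10)
    and c = less.prems(11,12) and d = less.prems(13,14)
  have xyz: "x \<noteq> y" "x \<noteq> z" "z \<noteq> y" using N by auto
  show ?case
  proof (cases "N = {y, z}")
    case True
    have ch: "{v. (v = y \<or> v = z) \<and> par v = u} =
        (if u = x then {y} else if u = y then {z} else {})" for u
      using par xyz by auto
    have load: "load N par w e u = (if u = x then e y else if u = y then w y * e y + e z
        else if u = z then w z * e z else 0)" for e u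
      using xyz unfolding True by (auto simp: load_def ch)
    have sum: "sum e N = e y + e z" for e :: "'a \<Rightarrow> nat"
      using True N(5) by simp
    have c': "w y * c y + c z \<le> m y" "w z * c z \<le> m z" "s \<le> c y + c z"
      using c(1)[of y] c(1)[of z] c(2) xyz by (auto simp: load sum)
    have d': "d y \<le> m x" "w z * d z \<le> m z" "s \<le> d y + d z"
      using d(1)[of x] d(1)[of z] d(2) xyz by (auto simp: load sum)
    have sol: ?thesis if "a \<le> m x" "w y * a + b \<le> m y" "w z * b \<le> m z" "s \<le> a + b" for a b
      using that xyz by (intro exI[of _ "(\<lambda>_. b)(y := a)"]) (auto simp: load sum)
    show ?thesis
    proof (cases "c y \<le> d y")
      case True
      then show ?thesis using sol[of "c y" "c z"] c' d' by simp
    next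
      case False
      then obtain j where j: "c y = d y + j" by (metis nat_le_linear le_Suc_ex)
      \<comment> \<open>Exchanging \<open>j\<close> copies of the arc into \<open>y\<close> for
        \<open>j\<close> copies of the arc into \<open>z\<close> does not raise the load at
        \<open>y\<close>.\<close>
      have "j \<le> w y * j" using w[of y] N by simp
      moreover have "w y * d y + w y * j + c z \<le> m y"
        using c'(1) by (simp add: j distrib_left)
      ultimately have room: "w y * d y + (c z + j) \<le> m y" by linarith
      \<comment> \<open>The arc into \<open>z\<close> gets the smaller of \<open>d z\<close> and
        \<open>c z + j\<close>: \<open>room\<close> gives the bound at \<open>y\<close>, the bound
        of \<open>d\<close> gives the one at \<open>z\<close>, and either total reaches
        \<open>s\<close>.\<close>
      show ?thesis
      proof (cases "d z \<le> c z + j")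
        case True
        then show ?thesis using sol[of "d y" "d z"] d' room by simp
      next
        case False
        then have "w z * (c z + j) \<le> m z"
          using d'(2) by (meson le_trans mult_le_mono2 nat_le_linear)
        then show ?thesis using sol[of "d y" "c z + j"] d' c' room by (simp add: j)
      qed
    qed
  next
    case False
    then have ne: "N - {y, z} \<noteq> {}" using N by auto
    obtain v where v: "v \<in> N - {y, z}" "\<And>u. u \<in> N - {y, z} \<Longrightarrow> r u \<le> r v"
      using obtains_MAX[of "N - {y, z}" r] ne N(1)
      by (metis Max_ge finite_Diff finite_imageI imageI)
    have vN: "v \<in> N" "v \<noteq> y" "v \<noteq> z" "v \<noteq> x" using v N by auto
    \<comment> \<open>A child of \<open>v\<close> other than \<open>y\<close>, \<open>z\<close>
      would have larger rank, and the parents of \<open>y\<close> and \<open>z\<close> are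
      \<open>x\<close> and \<open>y\<close>.\<close>
    have leaf: "par u \<noteq> v" if "u \<in> N" for u
      using that rank[of u] v(2)[of u] par vN by (cases "u \<in> {y, z}") (auto simp: not_less[symmetric])
    \<comment> \<open>As \<open>v\<close> and \<open>par v\<close> both avoid \<open>x\<close> and
      \<open>y\<close>, \<open>saturate_leaf\<close> applies with either set of enforced
      bounds.\<close>
    have pv: "par v \<in> N" "par v \<noteq> y" "par v \<noteq> x" "par v \<noteq> v" using par(3)[OF v(1)] N leaf vN by auto
    define g where "g = min (m v div w v) (m (par v))"
    \<comment> \<open>What the arc into \<open>v\<close> leaves at its parent. The entry at
      \<open>v\<close> may stay, since the remaining arcs do not load \<open>v\<close>.\<close>
    define m' where "m' = m(par v := m (par v) - g)"
    obtain c' where c': "c' v = g" "\<forall>u\<in>- {x}. load N par w c' u \<le> m u" "sum c N \<le> sum c' N"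
      using saturate_leaf[where par = par and w = w and W = "- {x}" and c = c and m = m, OF N(1) vN(1) leaf w pv(1)]
        c(1) pv vN unfolding g_def by blast
    obtain d' where d': "d' v = g" "\<forall>u\<in>- {y}. load N par w d' u \<le> m u" "sum d N \<le> sum d' N"
      using saturate_leaf[where par = par and w = w and W = "- {y}" and c = d and m = m, OF N(1) vN(1) leaf w pv(1)]
        d(1) pv vN unfolding g_def by blast
    have load_N: "load N par w e u =
        (if u = v then w v * e v else load (N - {v}) par w e u + (if u = par v then e v else 0))" for e u
      by (rule load_remove_leaf[where par = par, OF N(1) vN(1) leaf])
    have load_v: "load (N - {v}) par w e v = 0" for e
      using leaf by (auto simp: load_def intro!: sum.neutral)
    have sum_N: "sum e N = e v + sum e (N - {v})" for e :: "'a \<Rightarrow> nat"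
      by (rule sum.remove[OF N(1) vN(1)])
    have transfer: "load (N - {v}) par w e u \<le> m' u" if "e v = g" "load N par w e u \<le> m u" for e u
      using that pv(4) by (auto simp: load_N load_v m'_def split: if_splits)
    \<comment> \<open>Truncation of \<open>s - g\<close> at 0 is harmless: in either case adding the
      \<open>g\<close> copies of the arc into \<open>v\<close> gives at least
      \<open>s\<close>.\<close>
    have "\<exists>e. (\<forall>u. load (N - {v}) par w e u \<le> m' u) \<and> s - g \<le> sum e (N - {v})"
    proof (rule less.hyps[where c = c' and d = d'])
      show "card (N - {v}) < card N" using N(1) vN(1) by (rule card_Diff1_less)
      show "par u \<in> N - {v} - {y}" if "u \<in> N - {v} - {y, z}" for u
        using par(3)[of u] leaf that by auto
      show "s - g \<le> sum c' (N - {v})" using c(2) c' sum_N[of c'] by simp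
      show "s - g \<le> sum d' (N - {v})" using d(2) d' sum_N[of d'] by simp
      show "load (N - {v}) par w c' u \<le> m' u" if "u \<noteq> x" for u
        using transfer c' that by auto
      show "load (N - {v}) par w d' u \<le> m' u" if "u \<noteq> y" for u
        using transfer d' that by auto
    qed (use N par rank w vN in auto)
    then obtain e where e: "\<forall>u. load (N - {v}) par w e u \<le> m' u" "s - g \<le> sum e (N - {v})" by blast
    let ?e = "e(v := g)"
    have load_e: "load (N - {v}) par w ?e u = load (N - {v}) par w e u" for u
      by (auto simp: load_def intro!: sum.cong)
    have "w v * g \<le> m v"
      unfolding g_def by (meson le_trans min.cobounded1 mult_le_mono2 times_div_less_eq_dividend)
    moreover have "g \<le> m (par v)" by (simp add: g_def)
    ultimately have "load N par w ?e u \<le> m u" for u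
      using e(1)[rule_format, of u] pv(4) by (auto simp: load_N load_e m'_def split: if_splits)
    moreover have "s \<le> sum ?e N"
      using e(2) sum_N[of ?e] by simp
    ultimately show ?thesis by blast
  qed
qed


section \<open>Parents in oriented rooted trees\<close>

context oriented_rooted_tree
begin

lemma awalk_mk_symmetric:
  assumes "awalk u p v"
  shows "pre_digraph.awalk (mk_symmetric D) u p v"
proof -
  have "pcas u p v" "u \<in> pverts D" "set p \<subseteq> parcs D"
    using assms by (auto simp: awalk_def)
  then show ?thesis
    by (auto simp: pre_digraph.awalk_def cas_with_proj_eq parcs_mk_symmetric)
qed

text \<open>The arc would close the path to an undirected cycle. It has length at least 3, because
  loops and opposite arcs are excluded.\<close>

lemma no_arc_back:
  assumes "apath v p u" "(u, v) \<in> parcs D"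
  shows False
proof -
  have awalk: "awalk u ((u, v) # p) u" and dist: "distinct (pawalk_verts v p)"
    using assms in_arcsD1 by (auto simp: apath_def awalk_Cons_iff)
  have "length p \<ge> 2"
  proof (rule ccontr)
    assume "\<not> length p \<ge> 2"
    then consider "p = []" | e where "p = [e]"
      by (cases p; cases "tl p") auto
    then show False
    proof cases
      case 1
      then show False using assms pair_no_loops[OF assms(2)] by (auto simp: apath_def awalk_def)
    next
      case 2
      then have "(v, u) \<in> parcs D"
        using assms by (cases e) (auto simp: apath_def awalk_def)
      then show False using one_direction assms(2) by blast
    qed
  qed
  moreover have "pre_digraph.cycle (mk_symmetric D) ((u, v) # p)"
    unfolding pre_digraph.cycle_def
    using awalk_mk_symmetric[OF awalk] dist by (auto simp: awalk_verts_with_proj_eq)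
  ultimately show False
    using underlying_tree unfolding underlying_tree_def by force
qed

text \<open>If \<open>v\<close> occurred on the path already, the part from \<open>v\<close> to
  \<open>u\<close> would contradict \<open>no_arc_back\<close>. Together with uniqueness of directed
  paths this makes depth grow along arcs and parents unique.\<close>

lemma apath_snoc:
  assumes "apath z p u" "(u, v) \<in> parcs D"
  shows "apath z (p @ [(u, v)]) v"
proof -
  have "v \<notin> set (pawalk_verts z p)"
  proof
    assume "v \<in> set (pawalk_verts z p)"
    then obtain q r where "p = q @ r" "apath v r u"
      using assms(1) awalk_decomp[of z p u v] unfolding apath_def
      by (metis apath_append_iff apath_def awalk_ends awalkE)
    then show False using no_arc_back assms(2) by blast
  qed
  moreover have "awalk z (p @ [(u, v)]) v"
    using assms in_arcsD2 by (auto simp: apath_def awalk_def cas_append_iff)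
  moreover have "pawalk_verts z (p @ [(u, v)]) = pawalk_verts z p @ [v]"
    using assms awalk_verts_append[of z p "[(u, v)]" v] calculation by auto
  ultimately show ?thesis
    using assms(1) by (auto simp: apath_def)
qed

definition depth :: "'v \<Rightarrow> nat" where
  "depth v = length (THE p. apath z p v)"

lemma depth_eq:
  assumes "apath z p v"
  shows "depth v = length p"
proof -
  have "v \<in> pverts D" using assms unfolding apath_def by blast
  then show ?thesis
    unfolding depth_def using the1_equality[OF unique_directed_path assms] by simp
qed

lemma depth_arc:
  assumes "(u, v) \<in> parcs D"
  shows "depth u < depth v"
proof -
  obtain p where p: "apath z p u"
    using unique_directed_path[of u] assms in_arcsD1 by blast
  show ?thesis
    using depth_eq[OF p] depth_eq[OF apath_snoc[OF p assms]] by simp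
qed

lemma no_arc_into_root: "(u, z) \<notin> parcs D"
proof -
  have "apath z [] z" using root_in_verts by (simp add: apath_Nil_iff)
  then show ?thesis using depth_arc[of u z] by (auto simp: depth_eq)
qed

text \<open>The last arc of the path from \<open>z\<close> gives a parent; two parents would give
  two directed paths from \<open>z\<close> to \<open>v\<close>.\<close>

lemma unique_parent:
  assumes "v \<in> pverts D" "v \<noteq> z"
  shows "\<exists>!u. (u, v) \<in> parcs D"
proof -
  obtain p where p: "apath z p v"
    using unique_directed_path[OF assms(1)] by blast
  then have "p \<noteq> []" using assms by (auto simp: apath_Nil_iff)
  then obtain q e where "p = q @ [e]" by (metis rev_exhaust)
  then have "e \<in> parcs D" "snd e = v"
    using p by (auto simp: apath_def awalk_def cas_append_iff)
  then have "(fst e, v) \<in> parcs D" by (metis prod.collapse)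
  moreover have "u = u'" if arcs: "(u, v) \<in> parcs D" "(u', v) \<in> parcs D" for u u'
  proof -
    obtain p p' where "apath z p u" "apath z p' u'"
      using unique_directed_path arcs in_arcsD1 by meson
    then have "apath z (p @ [(u, v)]) v" "apath z (p' @ [(u', v)]) v"
      using apath_snoc that by blast+
    then have "p @ [(u, v)] = p' @ [(u', v)]"
      using unique_directed_path[OF assms(1)] by blast
    then show ?thesis by simp
  qed
  ultimately show ?thesis by blast
qed

end


section \<open>Monomial ideals\<close>

lemma poly_mapping_sum_single:
  "f = (\<Sum>m\<in>Poly_Mapping.keys f. Poly_Mapping.single m (Poly_Mapping.lookup f m))"
  by (rule poly_mapping_eqI)
    (simp add: lookup_sum lookup_single when_def in_keys_iff)

text \<open>The single case concerns only the terms of \<open>f\<close> itself, so facts about the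
  support of \<open>f\<close> can be used there without being part of \<open>P\<close>.\<close>

lemma poly_mapping_add_induct [case_names zero single add]:
  fixes f :: "'a \<Rightarrow>\<^sub>0 'b::comm_monoid_add"
  assumes "P 0"
    and "\<And>m. m \<in> Poly_Mapping.keys f \<Longrightarrow> P (Poly_Mapping.single m (Poly_Mapping.lookup f m))"
    and "\<And>g h. P g \<Longrightarrow> P h \<Longrightarrow> P (g + h)"
  shows "P f"
proof -
  have "P (\<Sum>m\<in>A. Poly_Mapping.single m (Poly_Mapping.lookup f m))"
    if "A \<subseteq> Poly_Mapping.keys f" for A
    using finite_subset[OF that finite_keys] that
    by (induction A rule: finite_induct) (simp_all add: assms)
  then show ?thesis
    by (metis poly_mapping_sum_single order_refl)
qed

lemma lookup_single_times:
  fixes f :: "'a::cancel_comm_monoid_add \<Rightarrow>\<^sub>0 'b::semiring_0"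
  shows "Poly_Mapping.lookup (Poly_Mapping.single a c * f) (a + k) = c * Poly_Mapping.lookup f k"
  by (simp add: lookup_mult lookup_single when_mult)

lemma keys_single_times:
  fixes f :: "'a::comm_monoid_add \<Rightarrow>\<^sub>0 'b::semiring_0"
  assumes "k \<in> Poly_Mapping.keys (Poly_Mapping.single a c * f)"
  shows "\<exists>l\<in>Poly_Mapping.keys f. k = a + l"
  using assms keys_mult[of "Poly_Mapping.single a c" f] by (auto split: if_splits)

lemma keys_add_nat:
  fixes a b :: "'v \<Rightarrow>\<^sub>0 nat"
  shows "Poly_Mapping.keys (a + b) = Poly_Mapping.keys a \<union> Poly_Mapping.keys b"
  by (auto simp: in_keys_iff lookup_add)

section \<open>The polynomial ring in the variables \<open>V\<close>\<close>

lemma polynomial_ring_simps [simp]: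
  "a \<otimes>\<^bsub>polynomial_ring V\<^esub> b = a * b" "a \<oplus>\<^bsub>polynomial_ring V\<^esub> b = a + b"
  "\<one>\<^bsub>polynomial_ring V\<^esub> = 1" "\<zero>\<^bsub>polynomial_ring V\<^esub> = 0"
  by (simp_all add: polynomial_ring_def)

lemma carrier_polynomial_ring:
  "f \<in> carrier (polynomial_ring V) \<longleftrightarrow> (\<forall>m\<in>Poly_Mapping.keys f. Poly_Mapping.keys m \<subseteq> V)"
  by (simp add: polynomial_ring_def)

lemma cring_polynomial_ring: "cring (polynomial_ring V :: ('v, 'k::field) mpoly ring)"
proof (rule cringI)
  let ?R = "polynomial_ring V :: ('v, 'k) mpoly ring"
  have add: "f + g \<in> carrier ?R" if "f \<in> carrier ?R" "g \<in> carrier ?R" for f g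
    using that keys_add[of f g] by (auto simp: carrier_polynomial_ring)
  have mult: "f * g \<in> carrier ?R" if f: "f \<in> carrier ?R" and g: "g \<in> carrier ?R" for f g
    unfolding carrier_polynomial_ring
  proof
    fix m assume "m \<in> Poly_Mapping.keys (f * g)"
    then obtain a b where "m = a + b" "a \<in> Poly_Mapping.keys f" "b \<in> Poly_Mapping.keys g"
      using keys_mult[of f g] by blast
    then show "Poly_Mapping.keys m \<subseteq> V"
      using f g by (auto simp: carrier_polynomial_ring keys_add_nat)
  qed
  have minus: "- f \<in> carrier ?R" if "f \<in> carrier ?R" for f
    using that by (simp add: carrier_polynomial_ring in_keys_iff)
  show "abelian_group ?R"
  proof (rule abelian_groupI)
    show "\<exists>g\<in>carrier ?R. g \<oplus>\<^bsub>?R\<^esub> f = \<zero>\<^bsub>?R\<^esub>" if "f \<in> carrier ?R" for f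
      using minus[OF that] by (intro bexI[of _ "- f"]) simp_all
  qed (simp_all add: add add.assoc add.commute, simp add: carrier_polynomial_ring)
  show "comm_monoid ?R"
    by (rule comm_monoidI) (simp_all add: mult mult.assoc mult.commute, simp add: carrier_polynomial_ring)
qed (simp add: distrib_right)

lemma a_inv_polynomial_ring:
  fixes f :: "('v, 'k::field) mpoly"
  assumes "f \<in> carrier (polynomial_ring V)"
  shows "\<ominus>\<^bsub>polynomial_ring V\<^esub> f = - f"
proof -
  interpret cring "polynomial_ring V :: ('v, 'k) mpoly ring" by (rule cring_polynomial_ring)
  have "- f \<in> carrier (polynomial_ring V)"
    using assms by (simp add: carrier_polynomial_ring in_keys_iff)
  then show ?thesis
    using assms by (intro minus_equality) simp_all
qed

text \<open>Divisibility of the support instead of generation lets membership be tested monomial by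
  monomial; \<open>genideal_monomials\<close> makes the link to generated ideals.\<close>

definition monomial_ideal :: "'v set \<Rightarrow> ('v \<Rightarrow>\<^sub>0 nat) set \<Rightarrow> ('v, 'k::field) mpoly set" where
  "monomial_ideal V A = {f \<in> carrier (polynomial_ring V).
     \<forall>m\<in>Poly_Mapping.keys f. \<exists>a\<in>A. \<forall>v. Poly_Mapping.lookup a v \<le> Poly_Mapping.lookup m v}"

lemma monomial_ideal_carrier: "f \<in> monomial_ideal V A \<Longrightarrow> f \<in> carrier (polynomial_ring V)"
  by (simp add: monomial_ideal_def)

lemma monomial_idealI:
  assumes "f \<in> carrier (polynomial_ring V)"
    and "\<And>m. m \<in> Poly_Mapping.keys f \<Longrightarrow>
      \<exists>a\<in>A. \<forall>v. Poly_Mapping.lookup a v \<le> Poly_Mapping.lookup m v"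
  shows "f \<in> monomial_ideal V A"
  using assms unfolding monomial_ideal_def by blast

lemma monomial_idealD:
  assumes "f \<in> monomial_ideal V A" "m \<in> Poly_Mapping.keys f"
  shows "\<exists>a\<in>A. \<forall>v. Poly_Mapping.lookup a v \<le> Poly_Mapping.lookup m v"
  using assms unfolding monomial_ideal_def by blast

lemma ideal_monomial_ideal:
  "ideal (monomial_ideal V A :: ('v, 'k::field) mpoly set) (polynomial_ring V)"
proof (rule idealI)
  let ?R = "polynomial_ring V :: ('v, 'k) mpoly ring"
  let ?M = "monomial_ideal V A :: ('v, 'k) mpoly set"
  interpret cring ?R by (rule cring_polynomial_ring)
  show "ring ?R" by (rule ring_axioms)
  show "subgroup ?M (add_monoid ?R)"
  proof (rule add.subgroupI)
    have "0 \<in> ?M" by (simp add: monomial_ideal_def carrier_polynomial_ring)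
    then show "?M \<noteq> {}" by blast
    show "\<ominus>\<^bsub>?R\<^esub> f \<in> ?M" if "f \<in> ?M" for f
      using that by (simp add: monomial_ideal_def carrier_polynomial_ring in_keys_iff a_inv_polynomial_ring)
    show "f \<oplus>\<^bsub>?R\<^esub> g \<in> ?M" if "f \<in> ?M" "g \<in> ?M" for f g
      using that add.m_closed[of f g] keys_add[of f g] by (auto simp: monomial_ideal_def)
  qed (auto simp: monomial_ideal_def)
  have mult: "g * f \<in> ?M" if f: "f \<in> ?M" and g: "g \<in> carrier ?R" for f g
  proof -
    have "\<exists>a\<in>A. \<forall>v. Poly_Mapping.lookup a v \<le> Poly_Mapping.lookup m v"
      if m: "m \<in> Poly_Mapping.keys (g * f)" for m
    proof -
      obtain b c where bc: "m = b + c" "c \<in> Poly_Mapping.keys f"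
        using keys_mult[of g f] m by blast
      then show ?thesis
        using monomial_idealD[OF f, of c] by (auto simp: lookup_add intro: trans_le_add2)
    qed
    moreover have "g * f \<in> carrier ?R"
      using m_closed[of g f] f g by (simp add: monomial_ideal_def)
    ultimately show ?thesis by (intro monomial_idealI) auto
  qed
  show "g \<otimes>\<^bsub>?R\<^esub> f \<in> ?M" "f \<otimes>\<^bsub>?R\<^esub> g \<in> ?M" if "f \<in> ?M" "g \<in> carrier ?R" for f g
    using mult[OF that] by (simp_all add: mult.commute)
qed

text \<open>A member is the sum of its terms, each a multiple of some generator. This serves both
  for generated ideals and for products.\<close>

lemma monomial_ideal_subset:
  fixes K :: "('v, 'k::field) mpoly set"
  assumes "0 \<in> K" and add: "\<And>f g. f \<in> K \<Longrightarrow> g \<in> K \<Longrightarrow> f + g \<in> K"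
    and single: "\<And>a b c. a \<in> A \<Longrightarrow> Poly_Mapping.keys (a + b) \<subseteq> V \<Longrightarrow> Poly_Mapping.single (a + b) c \<in> K"
  shows "monomial_ideal V A \<subseteq> K"
proof
  fix f :: "('v, 'k) mpoly" assume f: "f \<in> monomial_ideal V A"
  show "f \<in> K"
  proof (induction f rule: poly_mapping_add_induct)
    case (single m)
    then obtain a where a: "a \<in> A" "\<forall>v. Poly_Mapping.lookup a v \<le> Poly_Mapping.lookup m v"
      using monomial_idealD[OF f] by blast
    then have "m = a + (m - a)"
      by (intro poly_mapping_eqI) (simp add: lookup_add lookup_minus)
    moreover have "Poly_Mapping.keys m \<subseteq> V"
      using f single by (simp add: monomial_ideal_def carrier_polynomial_ring)
    ultimately show ?case using assms(3) a(1) by metis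
  qed (use assms in auto)
qed

lemma single_in_monomial_ideal:
  assumes "Poly_Mapping.keys m \<subseteq> V" "a \<in> A" "\<And>v. Poly_Mapping.lookup a v \<le> Poly_Mapping.lookup m v"
  shows "Poly_Mapping.single m c \<in> monomial_ideal V A"
  using assms by (auto simp: monomial_ideal_def carrier_polynomial_ring)

lemma genideal_monomials:
  assumes "\<And>a. a \<in> A \<Longrightarrow> Poly_Mapping.keys a \<subseteq> V"
  shows "Idl\<^bsub>polynomial_ring V\<^esub> ((\<lambda>a. Poly_Mapping.single a 1) ` A) =
    (monomial_ideal V A :: ('v, 'k::field) mpoly set)"
proof
  let ?R = "polynomial_ring V :: ('v, 'k) mpoly ring"
  let ?S = "(\<lambda>a. Poly_Mapping.single a 1) ` A"
  interpret cring ?R by (rule cring_polynomial_ring)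
  show "Idl\<^bsub>?R\<^esub> ?S \<subseteq> monomial_ideal V A"
    using assms by (intro genideal_minimal ideal_monomial_ideal) (auto intro: single_in_monomial_ideal)
  have S: "?S \<subseteq> carrier ?R"
    using assms by (auto simp: carrier_polynomial_ring)
  interpret I: ideal "Idl\<^bsub>?R\<^esub> ?S" ?R by (rule genideal_ideal[OF S])
  show "monomial_ideal V A \<subseteq> Idl\<^bsub>?R\<^esub> ?S"
  proof (rule monomial_ideal_subset)
    fix a b c assume a: "a \<in> A" "Poly_Mapping.keys (a + b) \<subseteq> V"
    then have "Poly_Mapping.single b c \<in> carrier ?R"
      by (auto simp: carrier_polynomial_ring keys_add_nat)
    moreover have "Poly_Mapping.single a 1 \<in> Idl\<^bsub>?R\<^esub> ?S"
      using genideal_self[OF S] a by blast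
    ultimately have "Poly_Mapping.single a 1 \<otimes>\<^bsub>?R\<^esub> Poly_Mapping.single b c \<in> Idl\<^bsub>?R\<^esub> ?S"
      by (intro I.I_r_closed)
    then show "Poly_Mapping.single (a + b) c \<in> Idl\<^bsub>?R\<^esub> ?S"
      by (simp add: mult_single)
  qed (use I.zero_closed I.a_closed in auto)
qed

section \<open>Products and powers of monomial ideals\<close>

lemma ideal_prod_monomial_ideal:
  assumes A: "\<And>a. a \<in> A \<Longrightarrow> Poly_Mapping.keys a \<subseteq> V"
  shows "ideal_prod (polynomial_ring V) (monomial_ideal V A) (monomial_ideal V B) =
    (monomial_ideal V {a + b | a b. a \<in> A \<and> b \<in> B} :: ('v, 'k::field) mpoly set)"
    (is "ideal_prod ?R ?I ?J = ?M")
proof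
  interpret cring ?R by (rule cring_polynomial_ring)
  interpret M: ideal ?M ?R by (rule ideal_monomial_ideal)
  interpret IJ: ideal "ideal_prod ?R ?I ?J" ?R
    by (intro ideal_prod_is_ideal ideal_monomial_ideal)
  show "ideal_prod ?R ?I ?J \<subseteq> ?M"
  proof
    fix f assume "f \<in> ideal_prod ?R ?I ?J"
    then show "f \<in> ?M"
    proof induction
      case (prod i j)
      have "\<exists>c\<in>{a + b | a b. a \<in> A \<and> b \<in> B}. \<forall>v. Poly_Mapping.lookup c v \<le> Poly_Mapping.lookup m v"
        if m: "m \<in> Poly_Mapping.keys (i * j)" for m
      proof -
        obtain m1 m2 where m12: "m = m1 + m2" "m1 \<in> Poly_Mapping.keys i" "m2 \<in> Poly_Mapping.keys j"
          using keys_mult[of i j] m by blast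
        obtain a where "a \<in> A" "\<forall>v. Poly_Mapping.lookup a v \<le> Poly_Mapping.lookup m1 v"
          using monomial_idealD[OF prod(1) m12(2)] by blast
        moreover obtain b where "b \<in> B" "\<forall>v. Poly_Mapping.lookup b v \<le> Poly_Mapping.lookup m2 v"
          using monomial_idealD[OF prod(2) m12(3)] by blast
        ultimately show ?thesis
          by (intro bexI[of _ "a + b"]) (auto simp: m12 lookup_add add_mono)
      qed
      moreover have "i * j \<in> carrier ?R"
        using m_closed[OF monomial_ideal_carrier monomial_ideal_carrier, OF prod(1) prod(2)] by simp
      ultimately show ?case
        unfolding polynomial_ring_simps by (intro monomial_idealI)
    next
      case (sum f g)
      then show ?case using M.a_closed by blast
    qed
  qed
  show "?M \<subseteq> ideal_prod ?R ?I ?J"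
  proof (rule monomial_ideal_subset)
    fix a b c assume "a \<in> {a + b | a b. a \<in> A \<and> b \<in> B}" and V: "Poly_Mapping.keys (a + b) \<subseteq> V"
    then obtain a1 b1 where ab: "a = a1 + b1" "a1 \<in> A" "b1 \<in> B" by blast
    \<comment> \<open>The cofactor \<open>b\<close> and the coefficient are put entirely into the
      second factor.\<close>
    have "Poly_Mapping.single a1 1 \<in> ?I" "Poly_Mapping.single (b1 + b) c \<in> ?J"
      using V ab by (auto simp: keys_add_nat lookup_add intro!: single_in_monomial_ideal)
    then have "Poly_Mapping.single a1 1 \<otimes>\<^bsub>?R\<^esub> Poly_Mapping.single (b1 + b) c \<in> ideal_prod ?R ?I ?J"
      by (rule ideal_prod.prod)
    then show "Poly_Mapping.single (a + b) c \<in> ideal_prod ?R ?I ?J"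
      by (simp add: mult_single ab add.assoc)
  qed (use IJ.zero_closed IJ.a_closed in auto)
qed

primrec power_generators :: "('v \<Rightarrow>\<^sub>0 nat) set \<Rightarrow> nat \<Rightarrow> ('v \<Rightarrow>\<^sub>0 nat) set" where
  "power_generators A 0 = {0}"
| "power_generators A (Suc s) = {a + b | a b. a \<in> power_generators A s \<and> b \<in> A}"

lemma keys_power_generators:
  assumes "\<And>a. a \<in> A \<Longrightarrow> Poly_Mapping.keys a \<subseteq> V"
  shows "a \<in> power_generators A s \<Longrightarrow> Poly_Mapping.keys a \<subseteq> V"
proof (induction s arbitrary: a)
  case (Suc s)
  then obtain b c where "a = b + c" "b \<in> power_generators A s" "c \<in> A" by auto
  then show ?case using Suc.IH[of b] assms[of c] by (simp add: keys_add_nat)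
qed simp

lemma ideal_power_monomial_ideal:
  assumes "\<And>a. a \<in> A \<Longrightarrow> Poly_Mapping.keys a \<subseteq> V"
  shows "ideal_power (polynomial_ring V) (monomial_ideal V A) s =
    (monomial_ideal V (power_generators A s) :: ('v, 'k::field) mpoly set)"
proof (induction s)
  case 0
  \<comment> \<open>The zeroth power is the whole ring, matching the generator 1 with exponent
    vector 0.\<close>
  show ?case by (auto simp: ideal_power_def ideals_set_def monomial_ideal_def)
next
  case (Suc s)
  then show ?case
    using ideal_prod_monomial_ideal[OF keys_power_generators[OF assms]]
    by (simp add: ideal_power_def ideals_set_def)
qed

section \<open>Primes generated by all variables but one\<close>

text \<open>The coefficient of \<open>q\<close> in \<open>f\<close>, with \<open>f\<close> regarded as a polynomial over \<open>k[x]\<close>.\<close>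

definition coeff_series :: "'v \<Rightarrow> ('v \<Rightarrow>\<^sub>0 nat) \<Rightarrow> ('v, 'k::field) mpoly \<Rightarrow> 'k fps" where
  "coeff_series x q f = Abs_fps (\<lambda>n. Poly_Mapping.lookup f (q + Poly_Mapping.single x n))"

text \<open>By minimality of \<open>q\<close> in \<open>f\<close> away from \<open>x\<close>, only
  pure powers of \<open>x\<close> in \<open>u\<close> contribute to the coefficient of
  \<open>q\<close> in \<open>u * f\<close>. For \<open>q = 0\<close> minimality is automatic, and
  \<open>coeff_series x 0\<close> is multiplicative.\<close>

lemma coeff_series_mult:
  fixes u f :: "('v, 'k::field) mpoly"
  assumes q: "Poly_Mapping.lookup q x = 0"
    and minimal: "\<And>m. m \<in> Poly_Mapping.keys f \<Longrightarrow>
      (\<And>v. v \<noteq> x \<Longrightarrow> Poly_Mapping.lookup m v \<le> Poly_Mapping.lookup q v) \<Longrightarrow>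
      (\<And>v. v \<noteq> x \<Longrightarrow> Poly_Mapping.lookup m v = Poly_Mapping.lookup q v)"
  shows "coeff_series x q (u * f) = coeff_series x 0 u * coeff_series x q f"
proof (induction u rule: poly_mapping_add_induct)
  case zero
  have "coeff_series x p (0 :: ('v, 'k) mpoly) = 0" for p
    by (simp add: coeff_series_def fps_eq_iff)
  then show ?case by simp
next
  case (add g h)
  have "coeff_series x p (f1 + f2) = coeff_series x p f1 + coeff_series x p f2" for p and f1 f2 :: "('v, 'k) mpoly"
    by (simp add: coeff_series_def fps_eq_iff lookup_add)
  then show ?case using add by (simp add: distrib_right)
next
  case (single a)
  define c where "c = Poly_Mapping.lookup u a"
  show ?case unfolding c_def[symmetric]
  proof (cases "\<exists>i. a = Poly_Mapping.single x i")
    case True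
    then obtain i where a: "a = Poly_Mapping.single x i" by blast
    have "Poly_Mapping.single x i = Poly_Mapping.single x n \<longleftrightarrow> i = n" for n
      by (metis lookup_single_eq)
    then have "coeff_series x 0 (Poly_Mapping.single a c) = fps_const c * fps_X ^ i"
      by (auto simp: coeff_series_def fps_eq_iff lookup_single when_def a)
    moreover have "coeff_series x q (Poly_Mapping.single a c * f) = fps_const c * fps_X ^ i * coeff_series x q f"
    proof (rule fps_ext)
      fix n
      show "fps_nth (coeff_series x q (Poly_Mapping.single a c * f)) n =
        fps_nth (fps_const c * fps_X ^ i * coeff_series x q f) n"
      proof (cases "i \<le> n")
        case True
        then have "q + Poly_Mapping.single x n = a + (q + Poly_Mapping.single x (n - i))"
          by (intro poly_mapping_eqI) (auto simp: a lookup_add lookup_single when_def)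
        then show ?thesis
          using True by (simp add: coeff_series_def lookup_single_times mult.assoc fps_X_power_mult_nth)
      next
        case False
        \<comment> \<open>The left side has exponent \<open>n < i\<close> at \<open>x\<close>,
          because \<open>q\<close> is free of \<open>x\<close>; every monomial of the product has at
          least \<open>i\<close>.\<close>
        have "q + Poly_Mapping.single x n \<notin> Poly_Mapping.keys (Poly_Mapping.single a c * f)"
        proof
          assume "q + Poly_Mapping.single x n \<in> Poly_Mapping.keys (Poly_Mapping.single a c * f)"
          then obtain l where "q + Poly_Mapping.single x n = a + l"
            using keys_single_times by blast
          then have "Poly_Mapping.lookup (q + Poly_Mapping.single x n) x = Poly_Mapping.lookup (a + l) x"
            by simp
          then show False using False q by (simp add: a lookup_add)
        qed
        then show ?thesis
          using False by (simp add: coeff_series_def in_keys_iff mult.assoc fps_X_power_mult_nth)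
      qed
    qed
    ultimately show "coeff_series x q (Poly_Mapping.single a c * f) = coeff_series x 0 (Poly_Mapping.single a c) * coeff_series x q f"
      by simp
  next
    case False
    have "coeff_series x 0 (Poly_Mapping.single a c) = 0"
      using False by (auto simp: coeff_series_def fps_eq_iff lookup_single when_def)
    moreover have "q + Poly_Mapping.single x n \<notin> Poly_Mapping.keys (Poly_Mapping.single a c * f)" for n
    proof
      assume "q + Poly_Mapping.single x n \<in> Poly_Mapping.keys (Poly_Mapping.single a c * f)"
      then obtain l where l: "l \<in> Poly_Mapping.keys f" "q + Poly_Mapping.single x n = a + l"
        using keys_single_times by blast
      have eq: "Poly_Mapping.lookup q v = Poly_Mapping.lookup a v + Poly_Mapping.lookup l v" if "v \<noteq> x" for v
        using arg_cong[OF l(2), of "\<lambda>m. Poly_Mapping.lookup m v"] that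
        by (simp add: lookup_add lookup_single)
      \<comment> \<open>Away from \<open>x\<close>, \<open>l\<close> divides \<open>q\<close>;
        minimality turns this into equality, leaving nothing for \<open>a\<close>.\<close>
      have "Poly_Mapping.lookup a v = 0" if "v \<noteq> x" for v
        using minimal[OF l(1), of v] eq that by simp
      then have "a = Poly_Mapping.single x (Poly_Mapping.lookup a x)"
        by (intro poly_mapping_eqI) (simp add: lookup_single when_def)
      then show False using False by blast
    qed
    then have "coeff_series x q (Poly_Mapping.single a c * f) = 0"
      by (simp add: coeff_series_def fps_eq_iff in_keys_iff)
    ultimately show "coeff_series x q (Poly_Mapping.single a c * f) = coeff_series x 0 (Poly_Mapping.single a c) * coeff_series x q f"
      by simp
  qed
qed

definition coordinate_prime :: "'v set \<Rightarrow> 'v \<Rightarrow> ('v, 'k::field) mpoly set" where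
  "coordinate_prime V x = monomial_ideal V ((\<lambda>v. Poly_Mapping.single v 1) ` (V - {x}))"

lemma coordinate_primeD:
  assumes "f \<in> coordinate_prime V x" "m \<in> Poly_Mapping.keys f"
  shows "\<exists>v\<in>V - {x}. Poly_Mapping.lookup m v > 0"
proof -
  obtain v where v: "v \<in> V - {x}"
      "\<forall>u. Poly_Mapping.lookup (Poly_Mapping.single v 1) u \<le> Poly_Mapping.lookup m u"
    using monomial_idealD[OF assms(1)[unfolded coordinate_prime_def] assms(2)] by blast
  then show ?thesis
    using v(2)[rule_format, of v] by (intro bexI[of _ v]) (auto simp: Suc_le_eq)
qed

text \<open>\<open>coeff_series x 0\<close> sets all variables other than \<open>x\<close> to 0, and
  the prime is the kernel of this map into a domain.\<close>

lemma coordinate_prime_iff: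
  assumes f: "f \<in> carrier (polynomial_ring V)"
  shows "f \<in> coordinate_prime V x \<longleftrightarrow> coeff_series x 0 f = 0"
proof
  assume "f \<in> coordinate_prime V x"
  then have "Poly_Mapping.single x n \<notin> Poly_Mapping.keys f" for n
    using coordinate_primeD[of f V x "Poly_Mapping.single x n"]
    by (auto simp: lookup_single when_def split: if_splits)
  then show "coeff_series x 0 f = 0"
    by (simp add: coeff_series_def fps_eq_iff in_keys_iff)
next
  assume *: "coeff_series x 0 f = 0"
  have "\<exists>v\<in>V - {x}. \<forall>u. Poly_Mapping.lookup (Poly_Mapping.single v 1) u \<le> Poly_Mapping.lookup m u"
    if m: "m \<in> Poly_Mapping.keys f" for m
  proof -
    have "m \<noteq> Poly_Mapping.single x (Poly_Mapping.lookup m x)"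
      using arg_cong[OF *, of "\<lambda>s. fps_nth s (Poly_Mapping.lookup m x)"] m
      by (auto simp: coeff_series_def in_keys_iff)
    then obtain v where v: "v \<noteq> x" "v \<in> Poly_Mapping.keys m"
      by (metis in_keys_iff lookup_single_eq lookup_single_not_eq poly_mapping_eqI)
    then have "v \<in> V" using f m by (auto simp: carrier_polynomial_ring)
    then show ?thesis
      using v by (intro bexI[of _ v]) (auto simp: lookup_single when_def in_keys_iff Suc_le_eq)
  qed
  then show "f \<in> coordinate_prime V x"
    using f by (simp add: coordinate_prime_def monomial_ideal_def)
qed

lemma primeideal_coordinate_prime:
  "primeideal (coordinate_prime V x :: ('v, 'k::field) mpoly set) (polynomial_ring V)"
proof (rule primeidealI)
  let ?R = "polynomial_ring V :: ('v, 'k) mpoly ring"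
  let ?P = "coordinate_prime V x :: ('v, 'k) mpoly set"
  interpret cring ?R by (rule cring_polynomial_ring)
  show "ideal ?P ?R" by (simp add: coordinate_prime_def ideal_monomial_ideal)
  show "cring ?R" by (rule cring_polynomial_ring)
  have "fps_nth (coeff_series x 0 (1 :: ('v, 'k) mpoly)) 0 = 1"
    by (simp add: coeff_series_def lookup_one)
  then have "coeff_series x 0 (1 :: ('v, 'k) mpoly) \<noteq> 0" by force
  then show "carrier ?R \<noteq> ?P"
    using coordinate_prime_iff[of 1 V x] one_closed by auto
  fix f g assume f: "f \<in> carrier ?R" and g: "g \<in> carrier ?R" and fg: "f \<otimes>\<^bsub>?R\<^esub> g \<in> ?P"
  have "coeff_series x 0 (f * g) = 0"
    using fg coordinate_prime_iff[of "f * g" V x] m_closed[OF f g] by simp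
  then have "coeff_series x 0 f * coeff_series x 0 g = 0"
    by (subst (asm) coeff_series_mult) auto
  then show "f \<in> ?P \<or> g \<in> ?P"
    using f g by (simp add: coordinate_prime_iff)
qed

text \<open>The prime is the annihilator of the class of \<open>h\<close>. Since the ideal is
  monomial, it is enough that \<open>h\<close> times any variable other than \<open>x\<close> lies
  in it while no \<open>h * x ^ n\<close> does.\<close>

lemma coordinate_prime_associated:
  fixes A :: "('v \<Rightarrow>\<^sub>0 nat) set"
  assumes h: "Poly_Mapping.keys h \<subseteq> V"
    and not_mem: "\<And>n a. a \<in> A \<Longrightarrow>
      \<exists>v. Poly_Mapping.lookup (h + Poly_Mapping.single x n) v < Poly_Mapping.lookup a v"
    and mem: "\<And>v. v \<in> V - {x} \<Longrightarrow>
      \<exists>a\<in>A. \<forall>u. Poly_Mapping.lookup a u \<le> Poly_Mapping.lookup (h + Poly_Mapping.single v 1) u"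
  shows "coordinate_prime V x \<in>
    associated_primes (polynomial_ring V) (monomial_ideal V A :: ('v, 'k::field) mpoly set)"
proof -
  let ?R = "polynomial_ring V :: ('v, 'k) mpoly ring"
  let ?I = "monomial_ideal V A :: ('v, 'k) mpoly set"
  let ?P = "coordinate_prime V x :: ('v, 'k) mpoly set"
  let ?h = "Poly_Mapping.single h 1 :: ('v, 'k) mpoly"
  interpret cring ?R by (rule cring_polynomial_ring)
  interpret I: ideal ?I ?R by (rule ideal_monomial_ideal)
  have h_carr: "?h \<in> carrier ?R"
    using h by (simp add: carrier_polynomial_ring)
  have colon: "r * ?h \<in> ?I \<longleftrightarrow> r \<in> ?P" if r: "r \<in> carrier ?R" for r
  proof
    assume *: "r * ?h \<in> ?I"
    have "Poly_Mapping.lookup r (Poly_Mapping.single x n) = 0" for n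
    proof (rule ccontr)
      assume "Poly_Mapping.lookup r (Poly_Mapping.single x n) \<noteq> 0"
      then have "h + Poly_Mapping.single x n \<in> Poly_Mapping.keys (r * ?h)"
        by (simp add: in_keys_iff mult.commute[of r] lookup_single_times)
      then obtain a where "a \<in> A"
          "\<forall>v. Poly_Mapping.lookup a v \<le> Poly_Mapping.lookup (h + Poly_Mapping.single x n) v"
        using monomial_idealD[OF *] by blast
      then show False using not_mem[of a n] by (auto simp: not_le[symmetric])
    qed
    then show "r \<in> ?P"
      using r by (simp add: coordinate_prime_iff coeff_series_def fps_eq_iff)
  next
    assume *: "r \<in> ?P"
    have "\<exists>a\<in>A. \<forall>u. Poly_Mapping.lookup a u \<le> Poly_Mapping.lookup m u"
      if m: "m \<in> Poly_Mapping.keys (r * ?h)" for m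
    proof -
      obtain l where l: "l \<in> Poly_Mapping.keys r" "m = h + l"
        using m keys_single_times[of m h 1 r] by (auto simp: mult.commute)
      then obtain v where v: "v \<in> V - {x}" "Poly_Mapping.lookup l v > 0"
        using coordinate_primeD[OF *] by blast
      from mem[OF v(1)] obtain a where a: "a \<in> A"
          "\<forall>u. Poly_Mapping.lookup a u \<le> Poly_Mapping.lookup (h + Poly_Mapping.single v 1) u" by blast
      have "Poly_Mapping.lookup a u \<le> Poly_Mapping.lookup m u" for u
        using a(2)[rule_format, of u] v(2) by (simp add: l lookup_add lookup_single when_def split: if_splits)
      then show ?thesis using a by blast
    qed
    moreover have "r * ?h \<in> carrier ?R" using m_closed[OF r h_carr] by simp
    ultimately show "r * ?h \<in> ?I" by (intro monomial_idealI) auto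
  qed
  have zero: "(?I +>\<^bsub>?R\<^esub> r) \<otimes>\<^bsub>?R Quot ?I\<^esub> (?I +>\<^bsub>?R\<^esub> ?h) = \<zero>\<^bsub>?R Quot ?I\<^esub> \<longleftrightarrow> r \<in> ?P"
    if r: "r \<in> carrier ?R" for r
  proof -
    have "(?I +>\<^bsub>?R\<^esub> r) \<otimes>\<^bsub>?R Quot ?I\<^esub> (?I +>\<^bsub>?R\<^esub> ?h) = ?I +>\<^bsub>?R\<^esub> (r * ?h)"
      using I.rcoset_mult_add[OF r h_carr] by (simp add: FactRing_def)
    moreover have "?I +>\<^bsub>?R\<^esub> (r * ?h) = ?I \<longleftrightarrow> r * ?h \<in> ?I"
      using m_closed[OF r h_carr] I.rcos_const_imp_mem[of "r * ?h"]
        a_rcos_zero[OF I.ideal_axioms, of "r * ?h"] by auto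
    ultimately show ?thesis
      using colon[OF r] by (simp add: FactRing_def)
  qed
  have "?P = {r \<in> carrier ?R. (?I +>\<^bsub>?R\<^esub> r) \<otimes>\<^bsub>?R Quot ?I\<^esub> (?I +>\<^bsub>?R\<^esub> ?h) = \<zero>\<^bsub>?R Quot ?I\<^esub>}"
  proof -
    have "?P \<subseteq> carrier ?R"
      unfolding coordinate_prime_def using monomial_ideal_carrier by blast
    then have "?P = {r \<in> carrier ?R. r \<in> ?P}" by blast
    also have "\<dots> = {r \<in> carrier ?R.
        (?I +>\<^bsub>?R\<^esub> r) \<otimes>\<^bsub>?R Quot ?I\<^esub> (?I +>\<^bsub>?R\<^esub> ?h) = \<zero>\<^bsub>?R Quot ?I\<^esub>}"
      by (rule Collect_cong) (simp only: zero cong: conj_cong)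
    finally show ?thesis .
  qed
  moreover have "?I +>\<^bsub>?R\<^esub> ?h \<in> carrier (?R Quot ?I)"
    using a_rcosetsI[OF I.a_subset h_carr] by (simp add: FactRing_def)
  ultimately have "\<exists>m\<in>carrier (?R Quot ?I).
      ?P = {r \<in> carrier ?R. (?I +>\<^bsub>?R\<^esub> r) \<otimes>\<^bsub>?R Quot ?I\<^esub> m = \<zero>\<^bsub>?R Quot ?I\<^esub>}"
    by (rule bexI)
  with primeideal_coordinate_prime show ?thesis
    unfolding associated_primes_def by (intro CollectI conjI)
qed

text \<open>
  Among the monomials of \<open>f\<close> violating the claim, one of minimal degree in the variables other
  than \<open>x\<close> cannot be cancelled in \<open>u * f\<close> by contributions of other monomials of \<open>f\<close>.
\<close>

lemma monomial_ideal_saturation: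
  fixes u f :: "('v, 'k::field) mpoly"
  assumes u: "u \<in> carrier (polynomial_ring V) - coordinate_prime V x"
    and uf: "u * f \<in> monomial_ideal V A" and m: "m \<in> Poly_Mapping.keys f"
  shows "\<exists>a\<in>A. \<forall>v. v \<noteq> x \<longrightarrow> Poly_Mapping.lookup a v \<le> Poly_Mapping.lookup m v"
proof (rule ccontr)
  define good where "good m \<longleftrightarrow> (\<exists>a\<in>A. \<forall>v. v \<noteq> x \<longrightarrow> Poly_Mapping.lookup a v \<le> Poly_Mapping.lookup m v)"
    for m :: "'v \<Rightarrow>\<^sub>0 nat"
  define U where "U = \<Union> (Poly_Mapping.keys ` Poly_Mapping.keys f) - {x}"
  define deg where "deg m = sum (Poly_Mapping.lookup m) U" for m :: "'v \<Rightarrow>\<^sub>0 nat"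
  have fin: "finite U" unfolding U_def by simp
  assume "\<not> ?thesis"
  then have "m \<in> Poly_Mapping.keys f \<and> \<not> good m" using m by (simp add: good_def)
  then obtain m0 where m0: "m0 \<in> Poly_Mapping.keys f" "\<not> good m0"
    and min: "\<And>m. m \<in> Poly_Mapping.keys f \<Longrightarrow> \<not> good m \<Longrightarrow> deg m0 \<le> deg m"
    using ex_has_least_nat[of "\<lambda>m. m \<in> Poly_Mapping.keys f \<and> \<not> good m" m deg] by metis
  \<comment> \<open>The part of \<open>m0\<close> free of \<open>x\<close>; minimality of
    \<open>deg m0\<close> will provide the hypothesis of \<open>coeff_series_mult\<close>.\<close>
  define q where "q = m0 - Poly_Mapping.single x (Poly_Mapping.lookup m0 x)"
  have q: "Poly_Mapping.lookup q v = (if v = x then 0 else Poly_Mapping.lookup m0 v)" for v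
    by (simp add: q_def lookup_minus lookup_single when_def)
  have m0_eq: "m0 = q + Poly_Mapping.single x (Poly_Mapping.lookup m0 x)"
    by (intro poly_mapping_eqI) (simp add: q lookup_add lookup_single when_def)
  have "coeff_series x q (u * f) = coeff_series x 0 u * coeff_series x q f"
  proof (rule coeff_series_mult)
    show "Poly_Mapping.lookup q x = 0" by (simp add: q)
    fix l v
    assume l: "l \<in> Poly_Mapping.keys f" and v: "v \<noteq> x"
      and le: "\<And>v. v \<noteq> x \<Longrightarrow> Poly_Mapping.lookup l v \<le> Poly_Mapping.lookup q v"
    \<comment> \<open>\<open>l\<close> divides \<open>m0\<close> away from \<open>x\<close>, so it
      inherits the violation and competes with \<open>m0\<close> for minimal degree.\<close>
    have "good m0" if "good l"
    proof -
      obtain a where "a \<in> A" "\<forall>v. v \<noteq> x \<longrightarrow> Poly_Mapping.lookup a v \<le> Poly_Mapping.lookup l v"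
        using \<open>good l\<close> unfolding good_def by blast
      moreover have "Poly_Mapping.lookup l v \<le> Poly_Mapping.lookup m0 v" if "v \<noteq> x" for v
        using le[OF that] that by (simp add: q)
      ultimately show ?thesis
        unfolding good_def by (intro bexI[of _ a]) (auto intro: le_trans)
    qed
    then have "\<not> good l" using m0(2) by blast
    then have "deg m0 \<le> deg l" using min l by blast
    show "Poly_Mapping.lookup l v = Poly_Mapping.lookup q v"
    proof (rule ccontr)
      assume "Poly_Mapping.lookup l v \<noteq> Poly_Mapping.lookup q v"
      then have lt: "Poly_Mapping.lookup l v < Poly_Mapping.lookup m0 v"
        using le[OF v] v by (simp add: q)
      then have "v \<in> U" using m0(1) v by (auto simp: U_def in_keys_iff intro!: bexI[of _ m0])
      moreover have "Poly_Mapping.lookup l u \<le> Poly_Mapping.lookup m0 u" if "u \<in> U" for u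
        using le[of u] that by (simp add: q U_def)
      ultimately have "deg l < deg m0"
        unfolding deg_def using fin lt by (intro sum_strict_mono_ex1) auto
      then show False using \<open>deg m0 \<le> deg l\<close> by simp
    qed
  qed
  moreover have "coeff_series x 0 u \<noteq> 0"
    using u coordinate_prime_iff[of u V x] by blast
  moreover have "fps_nth (coeff_series x q f) (Poly_Mapping.lookup m0 x) \<noteq> 0"
    using m0(1) m0_eq by (simp add: coeff_series_def in_keys_iff)
  then have "coeff_series x q f \<noteq> 0" by force
  ultimately have "coeff_series x q (u * f) \<noteq> 0" by simp
  then obtain n where "q + Poly_Mapping.single x n \<in> Poly_Mapping.keys (u * f)"
    by (auto simp: coeff_series_def fps_eq_iff in_keys_iff)
  then obtain a where a: "a \<in> A"
      "\<forall>v. Poly_Mapping.lookup a v \<le> Poly_Mapping.lookup (q + Poly_Mapping.single x n) v"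
    using monomial_idealD[OF uf] by blast
  have "Poly_Mapping.lookup a v \<le> Poly_Mapping.lookup m0 v" if "v \<noteq> x" for v
    using a(2)[rule_format, of v] that by (simp add: lookup_add lookup_single q)
  then show False using m0(2) a(1) by (auto simp: good_def)
qed


section \<open>Edge ideals of rooted trees\<close>

text \<open>An arc is named by its head, as every vertex other than the root has exactly one
  parent.\<close>

definition arc_monomial :: "('v \<Rightarrow> 'v) \<Rightarrow> ('v \<Rightarrow> nat) \<Rightarrow> 'v \<Rightarrow> 'v \<Rightarrow>\<^sub>0 nat" where
  "arc_monomial par w v = Poly_Mapping.single (par v) 1 + Poly_Mapping.single v (w v)"

lemma lookup_arc_monomial:
  "Poly_Mapping.lookup (arc_monomial par w v) u =
     (if u = v then w v else 0) + (if u = par v then 1 else 0)"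
  by (auto simp: arc_monomial_def lookup_add lookup_single when_def)

lemma var_power: "var v ^ n = Poly_Mapping.single (Poly_Mapping.single v n) 1"
proof (induction n)
  case (Suc n)
  then show ?case by (simp add: var_def mult_single flip: single_add)
qed simp

lemma edge_ideal_eq:
  fixes D :: "'v pair_pre_digraph"
  assumes "parcs D = {(par v, v) | v. v \<in> N}"
    and "\<And>v. v \<in> N \<Longrightarrow> v \<in> pverts D \<and> par v \<in> pverts D"
  shows "edge_ideal D w =
    (monomial_ideal (pverts D) (arc_monomial par w ` N) :: ('v, 'k::field) mpoly set)"
proof -
  have "{var u * var v ^ w v :: ('v, 'k) mpoly | u v. (u, v) \<in> parcs D} =
      (\<lambda>a. Poly_Mapping.single a 1) ` arc_monomial par w ` N"
    unfolding assms(1) var_power by (auto simp: var_def mult_single arc_monomial_def)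
  moreover have "Poly_Mapping.keys a \<subseteq> pverts D" if "a \<in> arc_monomial par w ` N" for a
    using that assms(2) by (auto simp: arc_monomial_def keys_add_nat split: if_splits)
  ultimately show ?thesis
    unfolding edge_ideal_def using genideal_monomials[of "arc_monomial par w ` N" "pverts D"]
    by (simp del: image_image)
qed

text \<open>A product of \<open>s\<close> generators is determined by how often each arc occurs.
  Membership in the power thus becomes a system of inequalities in multiplicities.\<close>

lemma power_generators_loads:
  assumes "finite N"
  shows "Poly_Mapping.lookup ` power_generators (arc_monomial par w ` N) s =
    {load N par w c | c. sum c N = s}"
proof (induction s)
  case 0
  have zero: "load N par w c = (\<lambda>u. 0)" if "sum c N = 0" for c
    using that assms by (auto simp: load_def fun_eq_iff)
  have "{load N par w c | c. sum c N = 0} = {\<lambda>u. 0}"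
  proof
    show "{\<lambda>u. 0} \<subseteq> {load N par w c | c. sum c N = 0}"
      using zero[of "\<lambda>_. 0"] by (auto intro!: exI[of _ "\<lambda>_. 0"])
  qed (use zero in auto)
  moreover have "Poly_Mapping.lookup (0 :: 'a \<Rightarrow>\<^sub>0 nat) = (\<lambda>u. 0)"
    by (rule ext) simp
  ultimately show ?case by simp
next
  case (Suc s)
  note IH = this
  show ?case
  proof (intro subset_antisym subsetI)
    fix l assume "l \<in> Poly_Mapping.lookup ` power_generators (arc_monomial par w ` N) (Suc s)"
    then obtain a v where l: "l = Poly_Mapping.lookup (a + arc_monomial par w v)"
      and a: "a \<in> power_generators (arc_monomial par w ` N) s" and v: "v \<in> N" by auto
    obtain c where c: "Poly_Mapping.lookup a = load N par w c" "sum c N = s"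
      using IH a by blast
    have "l = load N par w (c(v := Suc (c v)))"
      by (rule ext) (simp add: l lookup_add c lookup_arc_monomial load_update assms v)
    moreover have "sum (c(v := Suc (c v))) N = Suc s"
      using c sum_update_Suc[OF assms v, of c] by simp
    ultimately show "l \<in> {load N par w c | c. sum c N = Suc s}" by blast
  next
    fix l assume "l \<in> {load N par w c | c. sum c N = Suc s}"
    then obtain c where l: "l = load N par w c" and c: "sum c N = Suc s" by blast
    then obtain v where v: "v \<in> N" "c v > 0"
      by (metis gr_zeroI sum.neutral nat.distinct(1))
    define e where "e = c(v := c v - 1)"
    have ce: "c = e(v := Suc (e v))" using v by (auto simp: e_def)
    have "sum e N = s"
      using c sum_update_Suc[OF assms v(1), of e] by (simp add: ce[symmetric])
    then have "load N par w e \<in> Poly_Mapping.lookup ` power_generators (arc_monomial par w ` N) s"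
      unfolding IH by blast
    then obtain a where a: "a \<in> power_generators (arc_monomial par w ` N) s"
        "Poly_Mapping.lookup a = load N par w e"
      by auto
    have "l = Poly_Mapping.lookup (a + arc_monomial par w v)"
    proof
      fix u
      show "l u = Poly_Mapping.lookup (a + arc_monomial par w v) u"
        unfolding l lookup_add a(2) lookup_arc_monomial
        by (subst ce) (simp only: load_update[OF assms v(1)] add.assoc)
    qed
    then show "l \<in> Poly_Mapping.lookup ` power_generators (arc_monomial par w ` N) (Suc s)"
      using a v by auto
  qed
qed

lemma lookup_finite_support:
  fixes f :: "'v \<Rightarrow> nat"
  assumes "finite V" "\<And>v. v \<notin> V \<Longrightarrow> f v = 0"
  shows "Poly_Mapping.lookup (Abs_poly_mapping f) = f" "Poly_Mapping.keys (Abs_poly_mapping f) \<subseteq> V"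
proof -
  have "finite {v. f v \<noteq> 0}"
    by (rule finite_subset[OF _ assms(1)]) (metis (mono_tags, lifting) assms(2) mem_Collect_eq subsetI)
  then show eq: "Poly_Mapping.lookup (Abs_poly_mapping f) = f" by simp
  show "Poly_Mapping.keys (Abs_poly_mapping f) \<subseteq> V"
    by (metis assms(2) eq in_keys_iff subsetI)
qed

text \<open>The witnesses are \<open>x\<close> times the product of all \<open>v ^ (w v - 1)\<close>
  over \<open>N\<close>, and \<open>y ^ w y\<close> times that product over \<open>N - {y}\<close>.
  Each generator misses by one unit, at its head or, for the second witness and the arc into
  \<open>y\<close>, at \<open>x\<close>. A further variable completes an arc; tails other than
  \<open>x\<close> are present because weights exceed 1.\<close>

lemma coordinate_primes_associated:
  assumes V: "finite V" "N = V - {x}" "x \<in> V" "y \<in> N"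
    and par: "par y = x" "\<And>v. v \<in> N - {y} \<Longrightarrow> par v \<in> N" "\<And>v. v \<in> N \<Longrightarrow> par v \<noteq> v"
    and w: "\<And>v. v \<in> N \<Longrightarrow> w v > 1"
  defines "I \<equiv> monomial_ideal V (arc_monomial par w ` N) :: ('v, 'k::field) mpoly set"
  shows "coordinate_prime V x \<in> associated_primes (polynomial_ring V) I"
    and "coordinate_prime V y \<in> associated_primes (polynomial_ring V) I"
proof -
  have xy: "x \<noteq> y" using V by auto
  \<comment> \<open>The colon ideals of \<open>I\<close> by these two monomials are the two primes.\<close>
  define hx where "hx v = (if v = x then 1 else if v \<in> V then w v - 1 else 0)" for v
  define hy where "hy v = (if v = x then 0 else if v = y then w v else if v \<in> V then w v - 1 else 0)" for v
  have "hx v = 0" "hy v = 0" if "v \<notin> V" for v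
    using that V by (auto simp: hx_def hy_def)
  note hx = lookup_finite_support[OF V(1) this(1)] and hy = lookup_finite_support[OF V(1) this(2)]
  note lookups = lookup_add lookup_single when_def lookup_arc_monomial
  show "coordinate_prime V x \<in> associated_primes (polynomial_ring V) I"
    unfolding I_def
  proof (rule coordinate_prime_associated[OF hx(2)])
    fix n a assume "a \<in> arc_monomial par w ` N"
    then obtain v where v: "v \<in> N" "a = arc_monomial par w v" by blast
    then show "\<exists>u. Poly_Mapping.lookup (Abs_poly_mapping hx + Poly_Mapping.single x n) u < Poly_Mapping.lookup a u"
      using w[OF v(1)] V(2) by (intro exI[of _ v]) (auto simp: lookups hx hx_def)
  next
    fix v assume v: "v \<in> V - {x}"
    have "Poly_Mapping.lookup (arc_monomial par w v) u \<le>
        Poly_Mapping.lookup (Abs_poly_mapping hx + Poly_Mapping.single v 1) u" for u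
      using v V par(1) par(2)[of v] par(3)[of v] w[of v] w[of "par v"]
      by (cases "v = y") (auto simp: lookups hx hx_def)
    then show "\<exists>a\<in>arc_monomial par w ` N. \<forall>u. Poly_Mapping.lookup a u \<le>
        Poly_Mapping.lookup (Abs_poly_mapping hx + Poly_Mapping.single v 1) u"
      using v V by blast
  qed
  show "coordinate_prime V y \<in> associated_primes (polynomial_ring V) I"
    unfolding I_def
  proof (rule coordinate_prime_associated[OF hy(2)])
    fix n a assume "a \<in> arc_monomial par w ` N"
    then obtain v where v: "v \<in> N" "a = arc_monomial par w v" by blast
    \<comment> \<open>Powers of \<open>y\<close> never help: the arc into \<open>y\<close> lacks
      \<open>x\<close>, and any other arc lacks one unit at its head.\<close>
    then show "\<exists>u. Poly_Mapping.lookup (Abs_poly_mapping hy + Poly_Mapping.single y n) u < Poly_Mapping.lookup a u"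
      using w[OF v(1)] V(2) par(1) xy
      by (intro exI[of _ "if v = y then x else v"]) (auto simp: lookups hy hy_def)
  next
    fix v assume v: "v \<in> V - {y}"
    \<comment> \<open>The factor \<open>x\<close> completes the arc into \<open>y\<close>; any other
      variable completes the arc into itself.\<close>
    define v' where "v' = (if v = x then y else v)"
    have "v' \<in> N" using v V by (auto simp: v'_def)
    moreover have "Poly_Mapping.lookup (arc_monomial par w v') u \<le>
        Poly_Mapping.lookup (Abs_poly_mapping hy + Poly_Mapping.single v 1) u" for u
      using v V xy par(1) par(2)[of v] par(3)[of v] w[of v] w[of "par v"]
      by (cases "v = x") (auto simp: lookups hy hy_def v'_def)
    ultimately show "\<exists>a\<in>arc_monomial par w ` N. \<forall>u. Poly_Mapping.lookup a u \<le>
        Poly_Mapping.lookup (Abs_poly_mapping hy + Poly_Mapping.single v 1) u"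
      by blast
  qed
qed

text \<open>The whole graph is seen as a tree rooted at \<open>x\<close>, with arcs indexed by their
  heads \<open>N\<close>. The conditions on \<open>par\<close> make \<open>y\<close> the only child
  of \<open>x\<close> and \<open>z\<close> the only child of \<open>y\<close>; the rank excludes
  cycles below.\<close>

lemma symbolic_power_rooted_tree:
  fixes V :: "'v set" and r :: "'v \<Rightarrow> nat"
  assumes V: "finite V" "N = V - {x}" "x \<in> V" "y \<in> N" "z \<in> N" "y \<noteq> z"
    and par: "par y = x" "par z = y" "\<And>v. v \<in> N - {y, z} \<Longrightarrow> par v \<in> N - {y}"
    and rank: "\<And>v. v \<in> N - {y, z} \<Longrightarrow> r (par v) < r v"
    and w: "\<And>v. v \<in> N \<Longrightarrow> w v > 1"
  defines "I \<equiv> monomial_ideal V (arc_monomial par w ` N) :: ('v, 'k::field) mpoly set"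
  shows "symbolic_power (polynomial_ring V) I s = ideal_power (polynomial_ring V) I s"
proof -
  let ?R = "polynomial_ring V :: ('v, 'k) mpoly ring"
  let ?G = "power_generators (arc_monomial par w ` N) s"
  have N: "finite N" "x \<notin> N" using V by auto
  have par_V: "v \<in> V \<and> par v \<in> V" if "v \<in> N" for v
    using that V par(1,2) par(3)[of v] by (cases "v = y \<or> v = z") auto
  then have "Poly_Mapping.keys a \<subseteq> V" if "a \<in> arc_monomial par w ` N" for a
    using that by (auto simp: arc_monomial_def keys_add_nat split: if_splits)
  then have J: "ideal_power ?R I s = monomial_ideal V ?G"
    unfolding I_def by (rule ideal_power_monomial_ideal)
  have par_N: "par v \<in> N" if "v \<in> N - {y}" for v
    using that V par(2) par(3)[of v] by (cases "v = z") auto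
  have par_neq: "par v \<noteq> v" if "v \<in> N" for v
    using that V par(1,2) rank[of v] by (cases "v = y \<or> v = z") auto
  have primes: "coordinate_prime V x \<in> associated_primes ?R I" "coordinate_prime V y \<in> associated_primes ?R I"
    unfolding I_def using coordinate_primes_associated[where par = par and w = w, OF V(1-4) par(1) par_N par_neq w]
    by simp_all
  have solution: "\<exists>c. sum c N = s \<and> (\<forall>u. u \<noteq> p \<longrightarrow> load N par w c u \<le> Poly_Mapping.lookup m u)"
    if p: "coordinate_prime V p \<in> associated_primes ?R I" and f: "f \<in> symbolic_power ?R I s"
      and m: "m \<in> Poly_Mapping.keys f" for p f m
  proof -
    have "f \<in> local_contraction ?R (coordinate_prime V p) (monomial_ideal V ?G)"
      using f p by (auto simp: symbolic_power_def J)
    from local_contractionD[OF primeideal_coordinate_prime ideal_monomial_ideal this]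
    obtain u where "u \<in> carrier ?R - coordinate_prime V p" "u * f \<in> monomial_ideal V ?G"
      unfolding polynomial_ring_simps by (rule bexE)
    from monomial_ideal_saturation[OF this m]
    obtain a where a: "a \<in> ?G" "\<forall>v. v \<noteq> p \<longrightarrow> Poly_Mapping.lookup a v \<le> Poly_Mapping.lookup m v"
      by blast
    from a(1) have "Poly_Mapping.lookup a \<in> {load N par w c | c. sum c N = s}"
      unfolding power_generators_loads[OF N(1), of par w s, symmetric] by (rule imageI)
    then obtain c where "sum c N = s" "Poly_Mapping.lookup a = load N par w c"
      by blast
    then show ?thesis using a(2) by auto
  qed
  show ?thesis
  proof
    show "symbolic_power ?R I s \<subseteq> ideal_power ?R I s"
    proof
      fix f assume f: "f \<in> symbolic_power ?R I s"
      have "\<exists>a\<in>?G. \<forall>u. Poly_Mapping.lookup a u \<le> Poly_Mapping.lookup m u"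
        if m: "m \<in> Poly_Mapping.keys f" for m
      proof -
        obtain c where c: "sum c N = s" "\<And>u. u \<noteq> x \<Longrightarrow> load N par w c u \<le> Poly_Mapping.lookup m u"
          using solution[OF primes(1) f m] by blast
        obtain d where d: "sum d N = s" "\<And>u. u \<noteq> y \<Longrightarrow> load N par w d u \<le> Poly_Mapping.lookup m u"
          using solution[OF primes(2) f m] by blast
        have "\<exists>e. (\<forall>u. load N par w e u \<le> Poly_Mapping.lookup m u) \<and> s \<le> sum e N"
        proof (rule glue_solutions[where x = x and y = y and z = z and r = r and c = c and d = d])
          show "w v > 0" if "v \<in> N" for v
            using w[OF that] by simp
        qed (fact N V(4-6) par rank c(2) d(2) | simp add: c(1) d(1))+
        then obtain e where e: "\<And>u. load N par w e u \<le> Poly_Mapping.lookup m u" "s \<le> sum e N"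
          by blast
        obtain e' where e': "\<forall>v\<in>N. e' v \<le> e v" "sum e' N = s"
          using exists_sum_eq_le[OF N(1) e(2)] by blast
        then have "load N par w e' \<in> Poly_Mapping.lookup ` ?G"
          unfolding power_generators_loads[OF N(1)] by blast
        then obtain a where a: "a \<in> ?G" "Poly_Mapping.lookup a = load N par w e'"
          by auto
        have "Poly_Mapping.lookup a u \<le> Poly_Mapping.lookup m u" for u
          unfolding a(2) using load_mono[OF N(1), of e' e] e' e(1) by (meson le_trans)
        then show ?thesis using a(1) by blast
      qed
      then show "f \<in> ideal_power ?R I s"
        using f by (simp add: J monomial_ideal_def symbolic_power_def)
    qed
    have "ideal_power ?R I s \<subseteq> carrier ?R"
      by (auto simp: J monomial_ideal_def)
    then show "ideal_power ?R I s \<subseteq> symbolic_power ?R I s"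
      using subset_local_contraction[of "ideal_power ?R I s" ?R]
      unfolding symbolic_power_def by blast
  qed
qed

theorem theorem3p3:
  fixes D D' :: "'v pair_pre_digraph"
    and w :: "'v \<Rightarrow> nat"
    and x y z :: 'v
    and s :: nat
  assumes "weighted_oriented_graph D w"
    and "\<And>v. v \<in> pverts D \<Longrightarrow> w v > 1"
    and "oriented_rooted_tree D' w z"
    and "x \<noteq> y" and "x \<notin> pverts D'" and "y \<notin> pverts D'"
    and "pverts D = {x, y} \<union> pverts D'"
    and "parcs D = {(x, y), (y, z)} \<union> parcs D'"
    and "s \<ge> 1"
  shows "symbolic_power (polynomial_ring (pverts D)) (edge_ideal D w :: ('v, 'k::field) mpoly set) s =
         ideal_power (polynomial_ring (pverts D)) (edge_ideal D w :: ('v, 'k) mpoly set) s"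
proof -
  interpret T: oriented_rooted_tree D' w z by fact
  define N where "N = {y} \<union> pverts D'"
  \<comment> \<open>The two arcs outside \<open>D'\<close> are prescribed; at the other vertices of
    \<open>D'\<close>, \<open>unique_parent\<close> makes \<open>THE\<close> meaningful.\<close>
  define par where "par v = (if v = y then x else if v = z then y else THE u. (u, v) \<in> parcs D')" for v
  have yz: "y \<noteq> z" using assms(6) T.root_in_verts by blast
  have par_arc: "(par v, v) \<in> parcs D'" if "v \<in> N - {y, z}" for v
    using that theI'[OF T.unique_parent[of v]] by (auto simp: N_def par_def)
  have par_eq: "v \<in> N - {y, z} \<and> u = par v" if "(u, v) \<in> parcs D'" for u v
  proof -
    have v: "v \<in> pverts D'" "v \<noteq> z"
      using that T.in_arcsD2 T.no_arc_into_root by auto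
    then have "v \<noteq> y" using assms(6) by blast
    then show ?thesis
      using v the1_equality[OF T.unique_parent[OF v] that] by (auto simp: N_def par_def)
  qed
  have arcs: "parcs D = {(par v, v) | v. v \<in> N}"
  proof (intro subset_antisym subsetI)
    fix e assume "e \<in> parcs D"
    then consider "e = (x, y)" | "e = (y, z)" | "e \<in> parcs D'"
      using assms(8) by blast
    then show "e \<in> {(par v, v) | v. v \<in> N}"
    proof cases
      case 3
      then show ?thesis using par_eq[of "fst e" "snd e"] by (cases e) auto
    qed (use yz T.root_in_verts in \<open>auto simp: N_def par_def\<close>)
  next
    fix e assume "e \<in> {(par v, v) | v. v \<in> N}"
    then obtain v where "e = (par v, v)" "v \<in> N" by blast
    then show "e \<in> parcs D"
      using assms(8) par_arc[of v] yz by (cases "v = y \<or> v = z") (auto simp: par_def)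
  qed
  have verts: "v \<in> pverts D \<and> par v \<in> pverts D" if "v \<in> N" for v
    using that par_arc[of v] T.in_arcsD1 assms(7) unfolding N_def
    by (cases "v = y \<or> v = z") (auto simp: par_def)
  have I: "edge_ideal D w =
      (monomial_ideal (pverts D) (arc_monomial par w ` N) :: ('v, 'k) mpoly set)"
    using arcs verts by (rule edge_ideal_eq)
  show ?thesis
    unfolding I
  \<comment> \<open>Ranks are compared only along arcs of \<open>D'\<close>, so depth below
    \<open>z\<close> is a suitable rank for the whole tree.\<close>
  proof (rule symbolic_power_rooted_tree[where r = T.depth])
    show "finite (pverts D)" using assms(7) T.pair_finite_verts by simp
    show "N = pverts D - {x}" using assms(4,5,7) by (auto simp: N_def)
    show "par v \<in> N - {y}" if "v \<in> N - {y, z}" for v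
      using T.in_arcsD1[OF par_arc[OF that]] assms(6) by (auto simp: N_def)
    show "T.depth (par v) < T.depth v" if "v \<in> N - {y, z}" for v
      by (rule T.depth_arc[OF par_arc[OF that]])
    show "w v > 1" if "v \<in> N" for v
      using that assms(2,7) by (auto simp: N_def)
  qed (use assms(7) yz T.root_in_verts in \<open>auto simp: N_def par_def\<close>)
qed

end
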